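(* Let $\mathcal{U}_{-}$ be the set of all $(a,b)\in\mathbb{R}^2$ such that $\sqrt{2}<a<2$ and $$\max\left\{\tfrac{1}{8}\left(3a^2-8a+\sqrt{9a^4-16a^3}\right),\ 2-\sqrt{2}\,a\right\}<b<0,$$ where the first entry of the maximum is taken into account only when it is a real number (i.e. when $a\ge 16/9$). Then for every $(a,b)\in\mathcal{U}_{-}$ the Lozi map $f=f_{(a,b)}$ has a unique saddle-type fixed point in the lower half plane $\{y<0\}$, and the closure of the unstable manifold of this point is a chaotic attractor for $f$.
   Context: The Lozi map is $f_{(a,b)}:\mathbb{R}^2\to\mathbb{R}^2$, $f_{(a,b)}(x,y)=(1+y-a|x|,\,bx)$; for $b\neq0$ it is a homeomorphism. For a homeomorphism $g$ of a metric space $(M,d)$, a local unstable manifold at $q$ is a set $W^u_{q,\epsilon,loc}=\{r\in M:\lim_{n\to\infty}d(g^{-n}(q),g^{-n}(r))=0 \text{ and } d(g^{-i}(q),g^{-i}(r))<\epsilon \text{ for every } i\in\mathbb{N}\}$ for some $\epsilon>0$; the (global) unstable manifold is $W^u_q=\bigcup_{n\in\mathbb{N}}g^n(W^u_{g^{-n}(q),loc})$. A fixed point is of saddle type if the derivative there has one eigenvalue of modulus greater than 1 and one of modulus less than 1. Attractors: for a continuous map $h:S\to S$ and a closed set $F\subset S$, the realm of attraction $\rho(F)$ is the set of all $x\in S$ with $\omega(x)\subset F$, where $\omega(x)$ is the $\omega$-limit set of $x$. A set $F\subset S$ is an attractor if (A1) $\rho(F)$ has positive Lebesgue measure, and (A2)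 for any closed $F'\subset F$ with $\rho(F')=\rho(F)$ one has $F'=F$. The map $h$ is transitive if for any nonempty open $W,V$ there is $i\in\mathbb{N}$ with $h^i(W)\cap V\neq\emptyset$. A chaotic attractor is a compact invariant set $F$ that is an attractor, such that $h|_F$ is transitive and periodic points are dense in $F$. *)

theory Defs
  imports "HOL-Analysis.Analysis"
begin

definition lozi :: "real \<Rightarrow> real \<Rightarrow> real \<times> real \<Rightarrow> real \<times> real" where
  "lozi a b = (\<lambda>(x, y). (1 + y - a * \<bar>x\<bar>, b * x))"

(* The square root is real exactly when a >= 16/9 (for positive a). *)
definition U_minus :: "(real \<times> real) set" where
  "U_minus = {(a, b). sqrt 2 < a \<and> a < 2 \<and>
     (if 16 / 9 \<le> a
      then max (1 / 8 * (3 * a^2 - 8 * a + sqrt (9 * a^4 - 16 * a^3))) (2 - sqrt 2 * a)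
      else 2 - sqrt 2 * a) < b \<and> b < 0}"

(* Eigenvalues of the complexification of D: the equation D(u + iv) = mu (u + iv), for a nonzero
   complex vector u + iv, split into its real and imaginary parts. *)
definition complex_eigenvalue :: "('a::real_vector \<Rightarrow> 'a) \<Rightarrow> complex \<Rightarrow> bool" where
  "complex_eigenvalue D \<mu> \<longleftrightarrow>
     (\<exists>u v. (u \<noteq> 0 \<or> v \<noteq> 0) \<and>
        D u = Re \<mu> *\<^sub>R u - Im \<mu> *\<^sub>R v \<and>
        D v = Im \<mu> *\<^sub>R u + Re \<mu> *\<^sub>R v)"

(* In the plane the two eigenvalues required here are all the eigenvalues. *)
definition saddle_fixed_point :: "(real \<times> real \<Rightarrow> real \<times> real) \<Rightarrow> real \<times> real \<Rightarrow> bool" where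
  "saddle_fixed_point g p \<longleftrightarrow> g p = p \<and>
     (\<exists>D. (g has_derivative D) (at p) \<and>
        (\<exists>\<mu>. complex_eigenvalue D \<mu> \<and> cmod \<mu> > 1) \<and>
        (\<exists>\<mu>. complex_eigenvalue D \<mu> \<and> cmod \<mu> < 1))"

(* Here and in unstable_manifold, g is meant to be a homeomorphism, so inv g is its inverse. *)
definition local_unstable_manifold ::
  "('a::metric_space \<Rightarrow> 'a) \<Rightarrow> real \<Rightarrow> 'a \<Rightarrow> 'a set" where
  "local_unstable_manifold g \<epsilon> q =
     {r. (\<lambda>n. dist ((inv g ^^ n) q) ((inv g ^^ n) r)) \<longlonglongrightarrow> 0 \<and>
         (\<forall>i. dist ((inv g ^^ i) q) ((inv g ^^ i) r) < \<epsilon>)}"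

(* The size \<epsilon> > 0 of the local manifolds is a parameter; the union does not depend on it. *)
definition unstable_manifold ::
  "('a::metric_space \<Rightarrow> 'a) \<Rightarrow> real \<Rightarrow> 'a \<Rightarrow> 'a set" where
  "unstable_manifold g \<epsilon> q =
     (\<Union>n. (g ^^ n) ` local_unstable_manifold g \<epsilon> ((inv g ^^ n) q))"

definition omega_limit :: "('a::metric_space \<Rightarrow> 'a) \<Rightarrow> 'a \<Rightarrow> 'a set" where
  "omega_limit h x = {y. \<exists>r. strict_mono r \<and> (\<lambda>n. (h ^^ r n) x) \<longlonglongrightarrow> y}"

(* Nonemptiness of the limit set is automatic on a compact space. On a noncompact one it excludes
   orbits escaping to infinity, which would otherwise lie in the realm of every set. *)
definition realm :: "('a::metric_space \<Rightarrow> 'a) \<Rightarrow> 'a set \<Rightarrow> 'a set" where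
  "realm h F = {x. omega_limit h x \<noteq> {} \<and> omega_limit h x \<subseteq> F}"

(* emeasure is 0 on non-measurable sets, so positivity includes measurability of the realm. *)
definition attractor :: "('a::euclidean_space \<Rightarrow> 'a) \<Rightarrow> 'a set \<Rightarrow> bool" where
  "attractor h F \<longleftrightarrow> closed F \<and>
     emeasure lebesgue (realm h F) > 0 \<and>
     (\<forall>F'. closed F' \<and> F' \<subseteq> F \<and> realm h F' = realm h F \<longrightarrow> F' = F)"

definition transitive_on :: "'a::metric_space set \<Rightarrow> ('a \<Rightarrow> 'a) \<Rightarrow> bool" where
  "transitive_on F h \<longleftrightarrow>
     (\<forall>W V. openin (top_of_set F) W \<and> openin (top_of_set F) V \<and> W \<noteq> {} \<and> V \<noteq> {} \<longrightarrow>
        (\<exists>i. (h ^^ i) ` W \<inter> V \<noteq> {}))"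

definition chaotic_attractor :: "('a::euclidean_space \<Rightarrow> 'a) \<Rightarrow> 'a set \<Rightarrow> bool" where
  "chaotic_attractor h F \<longleftrightarrow>
     compact F \<and> h ` F = F \<and> attractor h F \<and> transitive_on F h \<and>
     F \<subseteq> closure {x \<in> F. \<exists>n>0. (h ^^ n) x = x}"

end

theory Submission
  imports Defs
begin

text \<open>
  Write \<open>a = l + m\<close> and \<open>b = - l m\<close>, so that \<open>- l\<close> and \<open>- m\<close> are the eigenvalues at the saddle \<open>X\<close> in
  the lower half plane. Then \<open>b > 2 - \<surd>2 a\<close> says \<open>l > \<surd>2\<close>, and the other condition on \<open>b\<close> becomes
  \<open>l\<^sup>2 + 3 l m < 2 (l + m)\<close>. The latter makes a triangle forward invariant; its sides lie on the
  unstable line, the stable line and a preimage of the stable line of the second fixed point. Hence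
  the unstable manifold \<open>W\<close> of \<open>X\<close> is bounded.

  Vectors in the cone of slopes at most \<open>m\<close> are stretched horizontally by at least \<open>l\<close>. A segment in
  \<open>W\<close> either contains a piece whose image after one or two steps is a segment longer by the factor
  \<open>l\<^sup>2 / 2 > 1\<close>, or its image contains a segment that joins the coordinate axes and so crosses the
  stable line of \<open>X\<close>. Since \<open>W\<close> is bounded, every segment
  in \<open>W\<close> contains a homoclinic point near which all the iterates involved are affine. The images of the
  segment then accumulate on all of \<open>W\<close>, which gives transitivity, and affine return maps near the
  homoclinic point have fixed points that are limits of points of \<open>W\<close>.

  The open triangle bounded by two segments of \<open>W\<close> and a segment of the stable line is attracted to the
  closure of \<open>W\<close>: its images have area tending to \<open>0\<close>, so each of their points is close to their boundary.
  Minimality holds because by Baire some point has the whole closure of \<open>W\<close> as its limit set.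
\<close>

subsection \<open>Limit sets and realms of attraction\<close>

text \<open>Visits to \<open>K\<close> at arbitrarily late times give a strictly increasing sequence
  of visiting times; compactness then extracts a convergent subsequence.\<close>

lemma omega_limit_meets_compact:
  assumes "compact K" "\<And>n. \<exists>k\<ge>n. (h ^^ k) x \<in> K"
  obtains y where "y \<in> K" "y \<in> omega_limit h x"
proof -
  have "\<exists>r. \<forall>n. (h ^^ r n) x \<in> K \<and> r n < r (Suc n)"
  proof (rule dependent_nat_choice)
    show "\<exists>k. (h ^^ k) x \<in> K" using assms(2) by blast
    show "\<exists>k'. (h ^^ k') x \<in> K \<and> k < k'" for k using assms(2)[of "Suc k"] unfolding Suc_le_eq by blast
  qed
  then obtain r where r: "\<And>n. (h ^^ r n) x \<in> K" "\<And>n. r n < r (Suc n)" by blast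
  obtain y q where q: "y \<in> K" "strict_mono q" "((\<lambda>n. (h ^^ r n) x) \<circ> q) \<longlonglongrightarrow> y"
    using assms(1) r(1) unfolding compact_def by metis
  have "strict_mono r" using r(2) by (simp add: strict_mono_Suc_iff)
  hence "strict_mono (r \<circ> q)" using q(2) by (rule strict_mono_o)
  moreover have "(\<lambda>n. (h ^^ (r \<circ> q) n) x) \<longlonglongrightarrow> y" using q(3) by (simp add: o_def)
  ultimately have "y \<in> omega_limit h x" unfolding omega_limit_def by blast
  thus ?thesis using that q(1) by blast
qed

text \<open>Quantifiers over the naturals only are the form needed for Borel measurability. Some
  ball is visited at arbitrarily late times, so a limit point exists; inside each ball the late
  iterates are closer to \<open>F\<close> than any given 1/(j+1), so no limit point lies off
  \<open>F\<close>.\<close>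

lemma realm_iff:
  fixes h :: "'a::euclidean_space \<Rightarrow> 'a"
  assumes "closed F" "F \<noteq> {}"
  shows "x \<in> realm h F \<longleftrightarrow>
    (\<exists>R::nat. \<forall>n. \<exists>k. n \<le> k \<and> norm ((h ^^ k) x) \<le> real R) \<and>
    (\<forall>(R::nat) (j::nat). \<exists>n. \<forall>k. n \<le> k \<longrightarrow>
       \<not> (norm ((h ^^ k) x) \<le> real R \<and> inverse (real (Suc j)) \<le> infdist ((h ^^ k) x) F))"
    (is "_ \<longleftrightarrow> ?bounded \<and> ?near")
proof
  assume x: "x \<in> realm h F"
  have ?bounded
  proof -
    obtain y r where r: "strict_mono r" "(\<lambda>n. (h ^^ r n) x) \<longlonglongrightarrow> y"
      using x by (auto simp: realm_def omega_limit_def)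
    obtain B where B: "\<And>n. norm ((h ^^ r n) x) \<le> B"
      using convergent_imp_Bseq[of "\<lambda>n. (h ^^ r n) x"] r(2) by (auto simp: convergent_def Bseq_def)
    obtain R :: nat where "B \<le> real R" using real_arch_simple by blast
    hence "n \<le> r n \<and> norm ((h ^^ r n) x) \<le> real R" for n
      using B[of n] seq_suble[OF r(1)] by (auto intro: order_trans)
    thus ?thesis by blast
  qed
  moreover have ?near
  proof (intro allI, rule ccontr)
    fix R j :: nat
    \<comment> \<open>\<open>K\<close> is compact and disjoint from \<open>F\<close>; visits to it
      at arbitrarily late times would put a limit point off \<open>F\<close>.\<close>
    define K where "K = cball 0 (real R) \<inter> {y. inverse (real (Suc j)) \<le> infdist y F}"
    assume "\<not> (\<exists>n. \<forall>k. n \<le> k \<longrightarrow>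
       \<not> (norm ((h ^^ k) x) \<le> real R \<and> inverse (real (Suc j)) \<le> infdist ((h ^^ k) x) F))"
    hence inK: "\<exists>k\<ge>n. (h ^^ k) x \<in> K" for n by (auto simp: K_def)
    have "compact K" unfolding K_def
      by (intro compact_Int_closed compact_cball closed_Collect_le continuous_intros)
    then obtain y where y: "y \<in> K" "y \<in> omega_limit h x" using omega_limit_meets_compact[OF _ inK] by blast
    hence "y \<in> F" using x by (auto simp: realm_def)
    thus False using y(1) by (simp add: K_def)
  qed
  ultimately show "?bounded \<and> ?near" by blast
next
  assume *: "?bounded \<and> ?near"
  then obtain R :: nat where R: "\<And>n. \<exists>k. n \<le> k \<and> norm ((h ^^ k) x) \<le> real R" by blast
  have "\<And>n. \<exists>k\<ge>n. (h ^^ k) x \<in> cball 0 (real R)" using R by simp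
  from omega_limit_meets_compact[OF compact_cball this] have "omega_limit h x \<noteq> {}" by blast
  moreover have "y \<in> F" if y: "y \<in> omega_limit h x" for y
  proof (rule ccontr)
    assume "y \<notin> F"
    hence "infdist y F \<noteq> 0" using in_closed_iff_infdist_zero[OF assms] by blast
    hence "0 < infdist y F" using infdist_nonneg[of y F] by linarith
    then obtain j where j: "inverse (real (Suc j)) < infdist y F" using reals_Archimedean by blast
    obtain R :: nat where R: "norm y < real R" using reals_Archimedean2 by blast
    obtain r where r: "strict_mono r" "(\<lambda>n. (h ^^ r n) x) \<longlonglongrightarrow> y" using y by (auto simp: omega_limit_def)
    obtain N where N: "\<And>k. N \<le> k \<Longrightarrow>
       \<not> (norm ((h ^^ k) x) \<le> real R \<and> inverse (real (Suc j)) \<le> infdist ((h ^^ k) x) F)"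
      using * by blast
    have "eventually (\<lambda>n. norm ((h ^^ r n) x) < real R) sequentially"
      using order_tendstoD(2)[OF tendsto_norm[OF r(2)] R] .
    moreover have "eventually (\<lambda>n. inverse (real (Suc j)) < infdist ((h ^^ r n) x) F) sequentially"
      using order_tendstoD(1)[OF tendsto_infdist[OF r(2)] j] .
    moreover have "eventually (\<lambda>n. N \<le> n) sequentially" by (rule eventually_ge_at_top)
    ultimately have "eventually (\<lambda>n. False) sequentially"
    proof eventually_elim
      case (elim n)
      thus ?case using N[of "r n"] seq_suble[OF r(1), of n] by auto
    qed
    thus False by simp
  qed
  ultimately show "x \<in> realm h F" by (auto simp: realm_def)
qed

lemma realm_in_borel:
  fixes h :: "'a::euclidean_space \<Rightarrow> 'a"
  assumes "closed F" "F \<noteq> {}" and h: "\<And>k. (h ^^ k) \<in> borel_measurable borel"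
  shows "realm h F \<in> sets borel"
proof -
  note h [measurable]
  have [measurable]: "(\<lambda>x. infdist x F) \<in> borel_measurable borel"
    by (intro borel_measurable_continuous_onI continuous_intros)
  have "realm h F = {x \<in> space borel. (\<exists>R::nat. \<forall>n. \<exists>k. n \<le> k \<and> norm ((h ^^ k) x) \<le> real R) \<and>
    (\<forall>(R::nat) (j::nat). \<exists>n. \<forall>k. n \<le> k \<longrightarrow>
       \<not> (norm ((h ^^ k) x) \<le> real R \<and> inverse (real (Suc j)) \<le> infdist ((h ^^ k) x) F))}"
    using realm_iff[OF assms(1,2), of _ h] by (simp only: space_borel UNIV_I simp_thms) blast
  also have "\<dots> \<in> sets borel" by measurable
  finally show ?thesis .
qed

lemma emeasure_lborel_vimage_plus:
  fixes S :: "real set"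
  assumes "S \<in> sets borel"
  shows "emeasure lborel ((+) t -` S) = emeasure lborel S"
proof -
  have "emeasure lborel S = emeasure (distr lborel borel ((+) t)) S" by (simp only: lborel_distr_plus)
  also have "\<dots> = emeasure lborel ((+) t -` S)" using assms by (subst emeasure_distr) auto
  finally show ?thesis by simp
qed

subsection \<open>Eigencoordinates at the saddle\<close>

locale lozi_saddle =
  fixes l m :: real
  assumes l_sq: "2 < l\<^sup>2" and l_pos: "0 < l" and m_pos: "0 < m"
    and lm_less_2: "l + m < 2" and trapping: "l\<^sup>2 + 3 * l * m < 2 * (l + m)"
begin

definition f :: "real \<times> real \<Rightarrow> real \<times> real" where
  "f = lozi (l + m) (- (l * m))"

text \<open>The x-coordinate of the saddle \<open>pt 0 0\<close>.\<close>

definition c :: real where "c = 1 / ((1 + l) * (1 + m))"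

text \<open>Eigencoordinates centred at the saddle: \<open>s\<close> runs along (1, l), the
  direction of the eigenvalue -m, and \<open>u\<close> along (1, m), the direction of the eigenvalue
  -l.\<close>

definition pt :: "real \<Rightarrow> real \<Rightarrow> real \<times> real" where
  "pt s u = (c + s + u, l * s + m * u - l * m * c)"

lemma f_eq: "f (x, y) = (1 + y - (l + m) * \<bar>x\<bar>, - (l * m) * x)"
  by (simp add: f_def lozi_def)

text \<open>A rational bound below sqrt 2, which turns many later estimates into linear
  arithmetic.\<close>

lemma l_gt: "7/5 < l"
proof (rule ccontr)
  assume "\<not> 7/5 < l"
  hence "l\<^sup>2 \<le> (7/5)\<^sup>2" using l_pos by (intro power_mono) auto
  thus False using l_sq by (simp add: power2_eq_square)
qed

lemma l_less: "l < 2" using lm_less_2 m_pos by simp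

lemma m_less: "m < 1/2"
proof (rule ccontr)
  assume "\<not> m < 1/2"
  \<comment> \<open>With m at least 1/2, \<open>trapping\<close> would give (3 l - 2)/2 < 2 l - l^2
    < 2 l - 2, that is l > 2.\<close>
  hence "1/2 * (3*l-2) \<le> m * (3*l-2)" using l_gt by (intro mult_right_mono) auto
  thus False using trapping l_sq l_less by (simp add: algebra_simps)
qed

lemma lm_pos: "0 < l * m" using l_pos m_pos by simp

lemma lm_less_1: "l * m < 1"
proof -
  have "l * m < 2 * (1/2)"
    using l_less m_less l_pos m_pos by (intro mult_strict_mono) auto
  thus ?thesis by simp
qed

lemma c_pos: "0 < c" using l_pos m_pos by (simp add: c_def)

lemma c_eq: "c * ((1 + l) * (1 + m)) = 1"
  using l_pos m_pos by (simp add: c_def)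

lemma c_eq': "c + l * c + m * c + l * m * c = 1"
  using c_eq by (simp add: algebra_simps)

lemma fst_pt [simp]: "fst (pt s u) = c + s + u"
  by (simp add: pt_def)

lemma f_pt:
  assumes "0 \<le> c + s + u"
  shows "f (pt s u) = pt (- m * s) (- l * u)"
  using assms c_eq' by (simp add: pt_def f_eq algebra_simps)

definition finv :: "real \<times> real \<Rightarrow> real \<times> real" where
  "finv = (\<lambda>(x, y). (- y / (l * m), x - 1 + (l + m) * \<bar>y / (l * m)\<bar>))"

lemma f_finv: "f (finv p) = p"
  using l_pos m_pos by (cases p) (simp add: finv_def f_eq abs_divide)

lemma finv_f: "finv (f p) = p"
  using l_pos m_pos by (cases p) (simp add: finv_def f_eq abs_mult)

lemma inv_f: "inv f = finv"
  by (intro inv_equality finv_f f_finv)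

lemma continuous_f: "continuous_on S f"
proof -
  have "f = (\<lambda>p. (1 + snd p - (l + m) * \<bar>fst p\<bar>, - (l * m) * fst p))"
    by (auto simp: f_eq fun_eq_iff)
  thus ?thesis by (auto intro!: continuous_intros)
qed

lemma continuous_funpow: "continuous_on S (f ^^ n)"
proof (induction n)
  case (Suc n)
  show ?case using continuous_on_compose[OF Suc continuous_f] by simp
qed (simp add: id_def)

lemma isCont_funpow: "isCont (f ^^ n) p"
  using continuous_funpow[of UNIV n] continuous_on_eq_continuous_at[OF open_UNIV] by blast

lemma tendsto_funpow: "(g \<longlongrightarrow> p) F \<Longrightarrow> ((\<lambda>x. (f ^^ n) (g x)) \<longlongrightarrow> (f ^^ n) p) F"
  using isCont_tendsto_compose[OF isCont_funpow] .

lemma continuous_pt [continuous_intros]: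
  "continuous_on S g \<Longrightarrow> continuous_on S h \<Longrightarrow> continuous_on S (\<lambda>x. pt (g x) (h x))"
  unfolding pt_def by (intro continuous_intros)

lemma tendsto_pt [tendsto_intros]:
  "(g \<longlongrightarrow> s) F \<Longrightarrow> (h \<longlongrightarrow> u) F \<Longrightarrow> ((\<lambda>x. pt (g x) (h x)) \<longlongrightarrow> pt s u) F"
  unfolding pt_def by (intro tendsto_intros)

lemma m_less_l: "m < l" using l_gt m_less by simp

definition s_coord :: "real \<times> real \<Rightarrow> real" where
  "s_coord p = (snd p + l * m * c - m * (fst p - c)) / (l - m)"

definition u_coord :: "real \<times> real \<Rightarrow> real" where
  "u_coord p = (l * (fst p - c) - (snd p + l * m * c)) / (l - m)"

lemma s_coord_pt [simp]: "s_coord (pt s u) = s"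
proof -
  have "l * s + m * u - l * m * c + l * m * c - m * (c + s + u - c) = s * (l - m)"
    by (simp add: algebra_simps)
  thus ?thesis using m_less_l by (simp add: s_coord_def pt_def del: diff_add_cancel)
qed

lemma u_coord_pt [simp]: "u_coord (pt s u) = u"
proof -
  have "l * (c + s + u - c) - (l * s + m * u - l * m * c + l * m * c) = u * (l - m)"
    by (simp add: algebra_simps)
  thus ?thesis using m_less_l by (simp add: u_coord_def pt_def del: diff_add_cancel)
qed

lemma pt_coords: "pt (s_coord p) (u_coord p) = p"
proof (cases p)
  case (Pair x y)
  have "l * (x - c) - (y + l * m * c) + (y + l * m * c - m * (x - c)) = (x - c) * (l - m)"
    by (simp add: algebra_simps)
  hence 1: "s_coord p + u_coord p = x - c"
    using m_less_l by (simp add: s_coord_def u_coord_def Pair add_divide_distrib[symmetric])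
  have "m * (l * (x - c) - (y + l * m * c)) + l * (y + l * m * c - m * (x - c))
      = (y + l * m * c) * (l - m)"
    by (simp add: algebra_simps)
  hence 2: "l * s_coord p + m * u_coord p = y + l * m * c"
    using m_less_l unfolding s_coord_def u_coord_def Pair fst_conv snd_conv times_divide_eq_right
      add_divide_distrib[symmetric] by (simp add: add.commute)
  show ?thesis using 1 2 by (simp add: pt_def Pair)
qed

lemma continuous_coords:
  "continuous_on S s_coord" "continuous_on S u_coord"
  unfolding s_coord_def u_coord_def using m_less_l by (auto intro!: continuous_intros)

lemma tendsto_coords:
  assumes "(g \<longlongrightarrow> pt s u) F"
  shows "((\<lambda>x. s_coord (g x)) \<longlongrightarrow> s) F" "((\<lambda>x. u_coord (g x)) \<longlongrightarrow> u) F"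
proof -
  have "isCont s_coord (pt s u)" "isCont u_coord (pt s u)"
    using continuous_coords[of UNIV] continuous_on_eq_continuous_at[OF open_UNIV] by blast+
  thus "((\<lambda>x. s_coord (g x)) \<longlongrightarrow> s) F" "((\<lambda>x. u_coord (g x)) \<longlongrightarrow> u) F"
    using assms by (auto dest: isCont_tendsto_compose)
qed

text \<open>Along the orbit |s| shrinks while |u| grows up to time \<open>k\<close>, so the bounds
  keep |s| + |u| at most \<open>c\<close>; hence the right-hand affine branch applies at each
  step.\<close>

lemma funpow_pt:
  assumes "\<bar>s\<bar> \<le> c / 2" "\<bar>l ^ k * u\<bar> \<le> c / 2"
  shows "(f ^^ k) (pt s u) = pt ((- m) ^ k * s) ((- l) ^ k * u)"
  using assms
proof (induction k arbitrary: s u)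
  case (Suc k)
  have "1 * \<bar>u\<bar> \<le> l ^ Suc k * \<bar>u\<bar>" using l_gt by (intro mult_right_mono one_le_power) auto
  hence u: "\<bar>u\<bar> \<le> c / 2" using Suc.prems(2) l_pos by (simp add: abs_mult)
  have "\<bar>m * s\<bar> \<le> 1 * \<bar>s\<bar>" unfolding abs_mult
    using m_pos m_less by (intro mult_right_mono) auto
  hence s: "\<bar>- m * s\<bar> \<le> c / 2" using Suc.prems(1) by simp
  have u2: "\<bar>l ^ k * (- l * u)\<bar> \<le> c / 2" using Suc.prems(2) by (simp add: abs_mult mult.assoc mult.left_commute)
  have "(f ^^ Suc k) (pt s u) = (f ^^ k) (f (pt s u))"
    by (simp only: funpow_Suc_right o_apply)
  also have "f (pt s u) = pt (- m * s) (- l * u)" using u Suc.prems(1) by (intro f_pt) linarith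
  finally show ?case using Suc.IH[OF s u2] by (simp add: mult_ac)
qed (simp add: pt_def)

text \<open>On the stable line the orbit stays in x >= 0 as soon as the point and its image do,
  because m < 1.\<close>

lemma funpow_pt_stable:
  assumes "- c \<le> s" "m * s \<le> c"
  shows "(f ^^ k) (pt s 0) = pt ((- m) ^ k * s) 0"
  using assms
proof (induction k arbitrary: s)
  case (Suc k)
  have "m * (m * s) \<le> m * c" using Suc.prems(2) m_pos by (intro mult_left_mono) auto
  moreover have "m * (- s) \<le> m * c" using Suc.prems m_pos by (intro mult_left_mono) auto
  moreover have "m * c \<le> 1 * c" "m * (m * c) \<le> 1 * c" using m_pos m_less c_pos
    by (auto intro!: mult_right_mono simp flip: mult.assoc simp: mult_le_one)
  moreover have "m * (m * (- s)) \<le> m * (m * c)" using Suc.prems m_pos by (intro mult_left_mono) auto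
  ultimately have "(f ^^ k) (pt (- m * s) 0) = pt ((- m) ^ k * (- m * s)) 0"
    using Suc.prems by (intro Suc.IH) auto
  moreover have "f (pt s 0) = pt (- m * s) 0" using f_pt[of s 0] Suc.prems by simp
  ultimately show ?case by (simp only: funpow_Suc_right o_apply) (simp add: mult_ac)
qed (simp add: pt_def)

section \<open>The unstable set as the forward images of a local segment\<close>

definition W :: "(real \<times> real) set" where
  "W = {(f ^^ n) (pt 0 u) | n u. \<bar>u\<bar> \<le> c / 4}"

lemma f_pt_unstable: "- c \<le> u \<Longrightarrow> f (pt 0 u) = pt 0 (- l * u)"
  using f_pt[of 0 u] by simp

lemma W_I: "\<bar>u\<bar> \<le> c / 4 \<Longrightarrow> pt 0 u \<in> W"
  unfolding W_def by (intro CollectI exI[of _ 0] exI[of _ u]) simp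

lemma f_W_subset: "p \<in> W \<Longrightarrow> f p \<in> W"
proof -
  assume "p \<in> W"
  then obtain n u where "p = (f ^^ n) (pt 0 u)" "\<bar>u\<bar> \<le> c / 4" by (auto simp: W_def)
  thus "f p \<in> W" unfolding W_def by (intro CollectI exI[of _ "Suc n"] exI[of _ u]) simp
qed

lemma funpow_W: "p \<in> W \<Longrightarrow> (f ^^ n) p \<in> W"
  by (induction n) (auto intro: f_W_subset)

text \<open>A backward step divides \<open>u\<close> by -l, and five of them bring [-c, c] into the
  local segment, as l^5 >= 4. The rest of the range, up to the turning point at u = l c, is covered
  by the image of [-c, 0].\<close>

lemma pt_in_W:
  assumes "- c \<le> u" "u \<le> l * c"
  shows "pt 0 u \<in> W"
proof -
  have 1: "pt 0 u \<in> W" if u: "\<bar>u\<bar> \<le> c" for u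
  proof -
    have step: "pt 0 u \<in> W" if "\<bar>u\<bar> \<le> c" "pt 0 (u / (- l)) \<in> W" for u
    proof -
      have "\<bar>u\<bar> / l \<le> c / 1" using that l_gt c_pos by (intro frac_le) auto
      hence "u / l \<le> c" using l_pos abs_ge_self[of "u / l"] by (simp add: abs_divide)
      hence "f (pt 0 (u / - l)) = pt 0 u" using f_pt_unstable[of "u / (- l)"] l_pos by auto
      thus ?thesis using f_W_subset[OF that(2)] by simp
    qed
    have s1: "\<bar>u\<bar> \<le> l ^ k * (c / 4) \<Longrightarrow> \<bar>u\<bar> \<le> c \<Longrightarrow> pt 0 u \<in> W" for k u
    proof (induction k arbitrary: u)
      case (Suc k)
      have a: "\<bar>u / (-l)\<bar> \<le> l ^ k * (c / 4)" using Suc.prems l_pos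
        by (simp add: abs_divide divide_le_eq mult_ac)
      have "\<bar>u\<bar> / l \<le> c / 1" using Suc.prems l_gt c_pos by (intro frac_le) auto
      hence "\<bar>u / (-l)\<bar> \<le> c" using l_pos by (simp add: abs_divide)
      thus ?case using step Suc.IH a Suc.prems by blast
    qed (simp add: W_I)
    have "4 \<le> l ^ 5"
    proof -
      have "(7/5) ^ 5 \<le> l ^ 5" using l_gt by (intro power_mono) auto
      thus ?thesis by (simp add: eval_nat_numeral)
    qed
    hence "4 * (c/4) \<le> l ^ 5 * (c / 4)" using c_pos by (intro mult_right_mono) auto
    thus ?thesis using s1[of u 5] u by simp
  qed
  show ?thesis
  proof (cases "\<bar>u\<bar> \<le> c")
    case False
    hence u: "u > c" using assms by auto
    have "u / l \<le> c" using assms l_pos by (simp add: divide_le_eq mult.commute)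
    hence "pt 0 (u / (- l)) \<in> W" using u c_pos l_pos by (intro 1) auto
    moreover have "f (pt 0 (u / (- l))) = pt 0 u"
      using \<open>u / l \<le> c\<close> l_pos by (subst f_pt_unstable) auto
    ultimately show ?thesis using f_W_subset by metis
  qed (simp add: 1)
qed

text \<open>A preimage is found by starting one step earlier, at \<open>u / (- l)\<close>, which
  still lies on the local segment.\<close>

lemma W_subset_f_W:
  assumes "p \<in> W" obtains q where "q \<in> W" "p = f q"
proof -
  obtain n u where nu: "p = (f ^^ n) (pt 0 u)" "\<bar>u\<bar> \<le> c / 4"
    using assms by (auto simp: W_def)
  have "\<bar>u\<bar> / l \<le> (c / 4) / 1" using nu l_gt c_pos by (intro frac_le) auto
  hence u: "\<bar>u / (- l)\<bar> \<le> c / 4" using l_pos by (simp add: abs_divide)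
  have "u \<le> c * 1" using nu c_pos by simp
  also have "\<dots> \<le> c * l" using c_pos l_gt by (intro mult_left_mono) auto
  finally have "u / l \<le> c" using l_pos by (simp add: divide_le_eq)
  hence "f (pt 0 (u / (- l))) = pt 0 u" using l_pos by (subst f_pt_unstable) auto
  hence "p = f ((f ^^ n) (pt 0 (u / (- l))))" using nu by (metis comp_apply funpow.simps(2) funpow_Suc_right)
  thus ?thesis using that W_I[OF u] funpow_W by blast
qed

lemma f_image_W: "f ` W = W"
  using f_W_subset W_subset_f_W by blast

subsection \<open>The unstable manifold and a trapping triangle\<close>

lemma pt_eq_iff: "pt s u = pt s' u' \<longleftrightarrow> s = s' \<and> u = u'"
  by (metis s_coord_pt u_coord_pt)

lemma finv_iterate_f: "(finv ^^ n) ((f ^^ n) p) = p"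
proof (induction n)
  case (Suc n)
  have "(finv ^^ Suc n) ((f ^^ Suc n) p) = (finv ^^ n) (finv (f ((f ^^ n) p)))"
    by (simp only: funpow_Suc_right[of n finv] funpow.simps(2)[of n f] o_apply)
  thus ?case by (simp add: finv_f Suc)
qed simp

lemma f_iterate_finv: "(f ^^ n) ((finv ^^ n) p) = p"
proof (induction n)
  case (Suc n)
  have "(f ^^ Suc n) ((finv ^^ Suc n) p) = (f ^^ n) (f (finv ((finv ^^ n) p)))"
    by (simp only: funpow_Suc_right[of n f] funpow.simps(2)[of n finv] o_apply)
  thus ?case by (simp add: f_finv Suc)
qed simp

lemma dist_pt_unstable: "dist (pt 0 0) (pt 0 u) = \<bar>u\<bar> * sqrt (1 + m\<^sup>2)"
proof -
  have "dist (pt 0 0) (pt 0 u) = sqrt (u\<^sup>2 + (m * u)\<^sup>2)"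
    by (simp add: pt_def dist_prod_def dist_real_def)
  also have "u\<^sup>2 + (m * u)\<^sup>2 = u\<^sup>2 * (1 + m\<^sup>2)"
    by (simp add: power_mult_distrib algebra_simps)
  finally show ?thesis by (simp only: real_sqrt_mult real_sqrt_abs)
qed

lemma funpow_fixed_point: "(f ^^ n) (pt 0 0) = pt 0 0"
  using funpow_pt[of 0 n 0] c_pos by simp

lemma finv_fixed_point: "(finv ^^ n) (pt 0 0) = pt 0 0"
  using finv_iterate_f[of n "pt 0 0"] by (simp add: funpow_fixed_point)

lemma finv_pt_unstable:
  assumes "\<bar>u\<bar> \<le> c / 2"
  shows "(finv ^^ n) (pt 0 u) = pt 0 (u / (- l) ^ n)"
proof -
  have "(f ^^ n) (pt 0 (u / (- l) ^ n)) = pt 0 u"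
    using funpow_pt[of 0 n "u / (- l) ^ n"] assms c_pos l_pos by (simp add: abs_mult abs_divide power_abs)
  thus ?thesis using finv_iterate_f by metis
qed

lemma unstable_coord_tendsto_0: "(\<lambda>n. u / (- l) ^ n) \<longlonglongrightarrow> 0"
proof -
  have "(\<lambda>n. u * (- 1 / l) ^ n) \<longlonglongrightarrow> u * 0"
    using l_gt by (intro tendsto_intros LIMSEQ_power_zero) auto
  moreover have "u * (- 1 / l) ^ n = u / (- l) ^ n" for n
    by (simp only: divide_minus_left minus_divide_right power_divide power_one) simp
  ultimately show ?thesis by simp
qed

text \<open>Going backwards, the s-coordinate is divided by -m at every step; it can stay bounded
  only if it is 0.\<close>

lemma backward_convergent_on_unstable_line:
  assumes "(\<lambda>n. (finv ^^ n) p) \<longlonglongrightarrow> pt 0 0"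
    and small: "\<And>n. \<bar>s_coord ((finv ^^ n) p)\<bar> \<le> c / 4" "\<And>n. \<bar>u_coord ((finv ^^ n) p)\<bar> \<le> c / 4"
  shows "p = pt 0 (u_coord p)"
proof -
  define s u where "s = (\<lambda>n. s_coord ((finv ^^ n) p))" and "u = (\<lambda>n. u_coord ((finv ^^ n) p))"
  have pt_su: "pt (s n) (u n) = (finv ^^ n) p" for n
    by (simp add: s_def u_def pt_coords)
  have step: "s n = - m * s (Suc n)" for n
  proof -
    have "pt (s n) (u n) = f (pt (s (Suc n)) (u (Suc n)))"
      by (simp add: pt_su f_finv)
    also have "\<dots> = pt (- m * s (Suc n)) (- l * u (Suc n))"
    proof (rule f_pt)
      show "0 \<le> c + s (Suc n) + u (Suc n)"
        using small[of "Suc n"] c_pos unfolding s_def u_def by linarith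
    qed
    finally show ?thesis by (simp add: pt_eq_iff)
  qed
  have s0: "s 0 = (- m) ^ n * s n" for n
  proof (induction n)
    case (Suc n)
    thus ?case unfolding step[of n] by simp
  qed simp
  have "\<bar>s 0\<bar> \<le> m ^ n * (c / 4)" for n
  proof -
    have "\<bar>s 0\<bar> = m ^ n * \<bar>s n\<bar>"
      using s0[of n] m_pos by (simp add: abs_mult power_abs)
    also have "\<dots> \<le> m ^ n * (c / 4)"
      using small(1)[of n] m_pos by (intro mult_left_mono) (auto simp: s_def)
    finally show ?thesis .
  qed
  moreover have "(\<lambda>n. m ^ n * (c / 4)) \<longlonglongrightarrow> 0 * (c / 4)"
    using m_pos m_less by (intro tendsto_intros LIMSEQ_power_zero) auto
  ultimately have "\<bar>s 0\<bar> \<le> 0"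
    by (intro LIMSEQ_le_const[of "\<lambda>n. m ^ n * (c / 4)"]) auto
  thus ?thesis using pt_coords[of p] by (simp add: s_def)
qed

text \<open>For one inclusion, a backward orbit converging to the saddle eventually stays near it
  and so lies on the local unstable segment. For the other, a point of the local segment that is
  pulled back far enough has its whole backward orbit within \<epsilon> of the saddle.\<close>

lemma unstable_manifold_eq:
  assumes "\<epsilon> > 0"
  shows "unstable_manifold f \<epsilon> (pt 0 0) = W"
proof (intro set_eqI iffI)
  fix p assume "p \<in> unstable_manifold f \<epsilon> (pt 0 0)"
  then obtain n q where p: "p = (f ^^ n) q" and q: "q \<in> local_unstable_manifold f \<epsilon> (pt 0 0)"
    by (auto simp: unstable_manifold_def inv_f finv_fixed_point)
  hence "(\<lambda>n. dist (pt 0 0) ((finv ^^ n) q)) \<longlonglongrightarrow> 0"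
    by (simp add: local_unstable_manifold_def inv_f finv_fixed_point)
  hence lim: "(\<lambda>n. (finv ^^ n) q) \<longlonglongrightarrow> pt 0 0"
    by (subst tendsto_dist_iff) (simp add: dist_commute)
  have "eventually (\<lambda>n. \<bar>s_coord ((finv ^^ n) q)\<bar> < c / 4) sequentially"
    "eventually (\<lambda>n. \<bar>u_coord ((finv ^^ n) q)\<bar> < c / 4) sequentially"
    using tendstoD[OF tendsto_coords(1)[OF lim], of "c / 4"]
      tendstoD[OF tendsto_coords(2)[OF lim], of "c / 4"] c_pos by (auto simp: dist_real_def)
  hence "eventually (\<lambda>n. \<bar>s_coord ((finv ^^ n) q)\<bar> < c / 4 \<and> \<bar>u_coord ((finv ^^ n) q)\<bar> < c / 4) sequentially"
    by (rule eventually_conj)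
  then obtain N where N: "\<And>n. n \<ge> N \<Longrightarrow>
      \<bar>s_coord ((finv ^^ n) q)\<bar> < c / 4 \<and> \<bar>u_coord ((finv ^^ n) q)\<bar> < c / 4"
    by (auto simp: eventually_sequentially)
  define r where "r = (finv ^^ N) q"
  have r_iter: "(finv ^^ n) r = (finv ^^ (n + N)) q" for n
    by (simp add: r_def funpow_add)
  have "r = pt 0 (u_coord r)"
  proof (rule backward_convergent_on_unstable_line)
    show "(\<lambda>n. (finv ^^ n) r) \<longlonglongrightarrow> pt 0 0"
      unfolding r_iter using lim by (rule LIMSEQ_ignore_initial_segment)
  qed (use N in \<open>auto simp: r_iter intro: less_imp_le\<close>)
  moreover have "\<bar>u_coord r\<bar> \<le> c / 4" using N[of N] by (simp add: r_def)
  ultimately have "r \<in> W" using W_I by metis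
  moreover have "p = (f ^^ n) ((f ^^ N) r)" by (simp add: p r_def f_iterate_finv)
  ultimately show "p \<in> W" by (simp add: funpow_W)
next
  fix p assume "p \<in> W"
  then obtain n u where p: "p = (f ^^ n) (pt 0 u)" and u: "\<bar>u\<bar> \<le> c / 4" by (auto simp: W_def)
  define C where "C = sqrt (1 + m\<^sup>2)"
  have C: "C > 0" by (simp add: C_def add_pos_nonneg)
  have "eventually (\<lambda>k. \<bar>u / (- l) ^ k\<bar> < \<epsilon> / C) sequentially"
    using tendstoD[OF unstable_coord_tendsto_0, of "\<epsilon> / C" u] assms C by (simp add: dist_real_def)
  then obtain k where k: "\<bar>u / (- l) ^ k\<bar> < \<epsilon> / C" by (auto simp: eventually_sequentially)
  define v where "v = u / (- l) ^ k"
  have decr: "\<bar>v / (- l) ^ i\<bar> \<le> \<bar>v\<bar>" for v i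
  proof -
    have "\<bar>v\<bar> / l ^ i \<le> \<bar>v\<bar> / 1" using l_gt by (intro frac_le) auto
    thus ?thesis using l_pos by (simp add: abs_divide power_abs)
  qed
  have v: "\<bar>v\<bar> \<le> c / 2" using decr[of u k] u c_pos by (simp add: v_def)
  have it: "(finv ^^ i) (pt 0 v) = pt 0 (v / (- l) ^ i)" for i using finv_pt_unstable[OF v] .
  have "pt 0 v \<in> local_unstable_manifold f \<epsilon> (pt 0 0)"
  proof -
    have "(\<lambda>i. \<bar>v / (- l) ^ i\<bar> * C) \<longlonglongrightarrow> \<bar>0\<bar> * C"
      by (intro tendsto_intros unstable_coord_tendsto_0)
    moreover have "\<bar>v / (- l) ^ i\<bar> * C < \<epsilon>" for i
    proof -
      have "\<bar>v / (- l) ^ i\<bar> < \<epsilon> / C" using decr[of v i] k by (simp add: v_def)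
      thus ?thesis using C by (simp add: pos_less_divide_eq)
    qed
    ultimately show ?thesis
      by (simp add: local_unstable_manifold_def inv_f finv_fixed_point it dist_pt_unstable C_def)
  qed
  moreover have "p = (f ^^ (n + k)) (pt 0 v)"
  proof -
    have "(finv ^^ k) (pt 0 u) = pt 0 v" using u c_pos by (simp add: finv_pt_unstable v_def)
    hence "pt 0 u = (f ^^ k) (pt 0 v)" by (metis f_iterate_finv)
    thus ?thesis by (simp add: p funpow_add)
  qed
  ultimately show "p \<in> unstable_manifold f \<epsilon> (pt 0 0)"
    by (auto simp: unstable_manifold_def inv_f finv_fixed_point)
qed

text \<open>The inequalities refer, in this order, to the stable line of the fixed point in x < 0,
  to the preimage of that line under the right-hand branch, and to the unstable line of the same
  fixed point.\<close>

definition T :: "(real \<times> real) set" where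
  "T = {(x, y). - (l / (l - 1)) \<le> y + l * x \<and> - (l / (l - 1)) \<le> y - (l + 2 * m) * x
      \<and> y + m * x \<le> m / (1 - m)}"

text \<open>Clearing denominators leads to \<open>trapping\<close>. The inequality puts (1/(1 - m),
  0) into \<open>T\<close>; this is the image of the point where the upper side of \<open>T\<close>
  meets the y-axis.\<close>

lemma trapping_ratio: "(l + 2 * m) / (1 - m) \<le> l / (l - 1)"
proof -
  have "(l + 2 * m) * (l - 1) \<le> l * (1 - m)"
    using trapping by (simp add: algebra_simps power2_eq_square)
  thus ?thesis using l_gt m_less by (simp add: pos_le_divide_eq pos_divide_le_eq)
qed

lemma f_T:
  assumes "p \<in> T" shows "f p \<in> T"
proof (cases p)
  case (Pair x y)
  define C K where "C = l / (l - 1)" and "K = m / (1 - m)"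
  \<comment> \<open>The identities for \<open>C\<close> and \<open>K\<close> express that two of the
    sides lie on invariant lines of the left-hand branch.\<close>
  have C: "C = 1 + C / l" using l_gt by (simp add: C_def field_simps)
  have lC: "l * C = l + C" using l_gt by (simp add: C_def field_simps)
  have K: "m * (1 + K) = K" using m_less by (simp add: K_def field_simps)
  have CK: "(l + 2 * m) * (1 + K) \<le> C"
    using trapping_ratio m_less by (simp add: K_def C_def field_simps)
  have h: "- C \<le> y + l * x" "- C \<le> y - (l + 2 * m) * x" "y + m * x \<le> K"
    using assms by (auto simp: T_def Pair C_def K_def)
  have 1: "- C \<le> - (l * m) * x + l * (1 + y - (l + m) * \<bar>x\<bar>)"
  proof (cases "0 \<le> x")
    case True
    have "l * (- C) \<le> l * (y - (l + 2 * m) * x)" using h(2) l_pos by (intro mult_left_mono) auto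
    thus ?thesis using True lC by (simp add: algebra_simps)
  next
    case False
    have "l * (- C) \<le> l * (y + l * x)" using h(1) l_pos by (intro mult_left_mono) auto
    thus ?thesis using False lC by (simp add: algebra_simps)
  qed
  have 2: "- (l * m) * x + m * (1 + y - (l + m) * \<bar>x\<bar>) \<le> K"
  proof -
    have "m * (y + m * x) \<le> m * K" using h(3) m_pos by (intro mult_left_mono) auto
    moreover have "m * ((l + m) * (x + \<bar>x\<bar>)) \<ge> 0" using m_pos l_pos by (intro mult_nonneg_nonneg) auto
    ultimately show ?thesis using K by (simp add: algebra_simps)
  qed
  have 3: "- C \<le> - (l * m) * x - (l + 2 * m) * (1 + y - (l + m) * \<bar>x\<bar>)"
  proof -
    have "(l + 2 * m) * (y + m * x) \<le> (l + 2 * m) * K" using h(3) l_pos m_pos by (intro mult_left_mono) auto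
    moreover have "(l + 2 * m) * (l + m) * \<bar>x\<bar> + 2 * m * m * x \<ge> 0"
    proof -
      have "2 * m * m * (\<bar>x\<bar> + x) \<ge> 0" using m_pos by (intro mult_nonneg_nonneg) auto
      moreover have "(l * l + 3 * l * m) * \<bar>x\<bar> \<ge> 0" using m_pos l_pos by (intro mult_nonneg_nonneg) auto
      ultimately show ?thesis by (simp add: algebra_simps)
    qed
    ultimately show ?thesis using CK by (simp add: algebra_simps)
  qed
  show ?thesis using 1 2 3 by (simp add: T_def Pair f_eq C_def K_def)
qed

lemma funpow_T: "p \<in> T \<Longrightarrow> (f ^^ n) p \<in> T"
  by (induction n) (auto intro: f_T)

lemma closed_T: "closed T"
proof -
  have "T = {p. - (l / (l - 1)) \<le> snd p + l * fst p} \<inter> {p. - (l / (l - 1)) \<le> snd p - (l + 2 * m) * fst p}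
      \<inter> {p. snd p + m * fst p \<le> m / (1 - m)}"
    by (auto simp: T_def)
  thus ?thesis by (auto intro!: closed_Int closed_Collect_le continuous_intros)
qed

text \<open>The modulus of the x-coordinate of the left vertex of \<open>T\<close>, which is the
  fixed point in x < 0.\<close>

definition bnd :: real where "bnd = (m / (1 - m) + l / (l - 1)) / (l - m)"

lemma T_fst_bound:
  assumes "p \<in> T" shows "\<bar>fst p\<bar> \<le> bnd"
proof -
  obtain x y where p: "p = (x, y)" by fastforce
  define C K where "C = l / (l - 1)" and "K = m / (1 - m)"
  have h: "- C \<le> y + l * x" "- C \<le> y - (l + 2 * m) * x" "y + m * x \<le> K"
    using assms by (auto simp: T_def p C_def K_def)
  have "- x * (l - m) \<le> K + C" using h by (simp add: algebra_simps)
  moreover have "x * (l - m) \<le> K + C"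
  proof (cases "0 \<le> x")
    case True
    have "x * (l - m) \<le> x * (l + 3 * m)" using True m_pos by (intro mult_left_mono) auto
    thus ?thesis using h by (simp add: algebra_simps)
  next
    case False
    have "x * (l - m) \<le> 0" using False m_less_l by (intro mult_nonpos_nonneg) auto
    moreover have "K + C \<ge> 0" using m_pos m_less l_gt by (simp add: K_def C_def)
    ultimately show ?thesis by simp
  qed
  ultimately show ?thesis using m_less_l
    by (simp add: bnd_def p pos_le_divide_eq abs_le_iff flip: C_def K_def)
qed

lemma compact_T: "compact T"
proof -
  have "T \<subseteq> {- bnd..bnd} \<times> {- (l / (l - 1)) - l * bnd..m / (1 - m) + m * bnd}"
  proof
    fix p assume p: "p \<in> T"
    have "\<bar>fst p\<bar> \<le> bnd" using T_fst_bound[OF p] .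
    hence "l * fst p \<le> l * bnd" "m * (- fst p) \<le> m * bnd"
      using l_pos m_pos by (intro mult_left_mono; simp)+
    thus "p \<in> {- bnd..bnd} \<times> {- (l / (l - 1)) - l * bnd..m / (1 - m) + m * bnd}"
      using p \<open>\<bar>fst p\<bar> \<le> bnd\<close> by (auto simp: T_def abs_le_iff)
  qed
  moreover have "bounded ({- bnd..bnd} \<times> {- (l / (l - 1)) - l * bnd..m / (1 - m) + m * bnd})"
    by (intro bounded_Times bounded_closed_interval)
  ultimately show ?thesis using closed_T bounded_subset compact_eq_bounded_closed by blast
qed

lemma W_subset_T: "W \<subseteq> T"
proof
  have start: "pt 0 u \<in> T" if u: "\<bar>u\<bar> \<le> c / 4" for u
  proof -
    have C: "2 \<le> l / (l - 1)" using l_gt l_less by (simp add: pos_le_divide_eq)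
    have c_less: "c \<le> 5/12"
    proof -
      have "12/5 * 1 \<le> (1 + l) * (1 + m)" using l_gt m_pos by (intro mult_mono) auto
      hence "c * (12/5) \<le> c * ((1 + l) * (1 + m))" using c_pos by (intro mult_left_mono) auto
      thus ?thesis using c_eq by simp
    qed
    have mc: "m * \<bar>u\<bar> \<le> 1/2 * (c/4)" using u m_less m_pos by (intro mult_mono) auto
    have mu: "\<bar>m * u\<bar> \<le> c / 8" using mc m_pos by (simp add: abs_mult)
    have lmc: "l * m * c \<le> 1 * c" "0 \<le> l * m * c" using lm_less_1 lm_pos c_pos by (auto intro!: mult_right_mono)
    have x: "3/4 * c \<le> c + u" "c + u \<le> 5/4 * c" using u by linarith+
    have lx: "0 \<le> l * (c + u)" using x c_pos l_pos by simp
    have lx2: "(l + 2 * m) * (c + u) \<le> 5/2 * (5/4 * c)" using x c_pos l_pos lm_less_2 m_less m_pos by (intro mult_mono) auto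
    have mx: "m * (c + u) - l * m * c \<le> m / (1 - m) - m * u"
    proof -
      have "(c + u) - l * c + u \<le> 1" using u c_less l_gt c_pos mult_right_mono[of "7/5" l c] by linarith
      hence "m * ((c + u) - l * c + u) \<le> m * 1" using m_pos by (intro mult_left_mono) auto
      moreover have "m / 1 \<le> m / (1 - m)" using m_pos m_less by (intro frac_le) auto
      ultimately show ?thesis by (simp add: algebra_simps)
    qed
    have "m * u \<le> c / 8" "- (c / 8) \<le> m * u" using mu by linarith+
    thus ?thesis unfolding T_def pt_def mem_Collect_eq prod.case mult_zero_right add_0_right add_0_left
      using C c_less lmc lx lx2 mx c_pos by (intro conjI) linarith+
  qed
  fix p assume "p \<in> W"
  then obtain n u where "p = (f ^^ n) (pt 0 u)" "\<bar>u\<bar> \<le> c / 4" by (auto simp: W_def)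
  thus "p \<in> T" using funpow_T[OF start] by metis
qed

text \<open>The lower bound is the height at which the stable line of the saddle meets the y-axis,
  the upper one the top of \<open>T\<close> there. For the lower bound, a preimage in
  \<open>W\<close> obeys the upper inequality of \<open>T\<close> and is mapped to x = 0; this
  bounds its x-coordinate and hence \<open>y\<close>.\<close>

lemma W_critical_line:
  assumes "(0, y) \<in> W"
  shows "- l / (1 + l) < y" "y \<le> m / (1 - m)"
proof -
  have "(0, y) \<in> T" using assms W_subset_T by auto
  thus "y \<le> m / (1 - m)" by (simp add: T_def)
  obtain q where q: "q \<in> W" "(0, y) = f q" using W_subset_f_W[OF assms] by blast
  obtain x' y' where q': "q = (x', y')" by fastforce
  have y: "y = - (l * m) * x'" and e: "1 + y' = (l + m) * \<bar>x'\<bar>" using q by (auto simp: q' f_eq)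
  have "y' + m * x' \<le> m / (1 - m)" using q W_subset_T by (auto simp: q' T_def)
  hence "(l + m) * \<bar>x'\<bar> + m * x' \<le> m / (1 - m) + 1" using e by simp
  also have "\<dots> = 1 / (1 - m)" using m_less by (simp add: field_simps)
  finally have b: "(l + m) * \<bar>x'\<bar> + m * x' \<le> 1 / (1 - m)" .
  have "x' < 1 / (m * (1 + l))"
  proof (cases "x' > 0")
    case True
    hence "(l + 2 * m) * x' \<le> 1 / (1 - m)" using b by (simp add: algebra_simps)
    moreover have "1 / (1 - m) < (l + 2 * m) / (m * (1 + l))"
    proof -
      have "0 < (l + m) * (1 - 2 * m)" using l_pos m_pos m_less by (intro mult_pos_pos) auto
      hence "m * (1 + l) < (l + 2 * m) * (1 - m)" by (simp add: algebra_simps)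
      thus ?thesis using m_pos l_pos m_less by (simp add: pos_less_divide_eq pos_divide_less_eq)
    qed
    ultimately have "(l + 2 * m) * x' < (l + 2 * m) * (1 / (m * (1 + l)))" by simp
    thus ?thesis using l_pos m_pos by (subst (asm) mult_less_cancel_left_pos) auto
  next
    case False
    have "0 < 1 / (m * (1 + l))" using m_pos l_pos by simp
    thus ?thesis using False by linarith
  qed
  hence "l * m * x' < l * m * (1 / (m * (1 + l)))" using lm_pos by (intro mult_strict_left_mono) auto
  also have "\<dots> = l / (1 + l)" using m_pos by simp
  finally show "- l / (1 + l) < y" using y by simp
qed

subsection \<open>Growth of unstable segments\<close>

text \<open>The derivative of \<open>f\<close> on the half plane where \<sigma> x > 0, for \<sigma>
  = 1 or -1.\<close>

definition branch :: "real \<Rightarrow> real \<times> real \<Rightarrow> real \<times> real" where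
  "branch \<sigma> = (\<lambda>(x, y). (y - (l + m) * \<sigma> * x, - (l * m) * x))"

definition unstable_cone :: "(real \<times> real) set" where
  "unstable_cone = {v. \<bar>snd v\<bar> \<le> m * \<bar>fst v\<bar>}"

lemma linear_branch: "linear (branch \<sigma>)"
  by (rule linearI) (auto simp: branch_def algebra_simps)

lemma f_add:
  assumes "\<bar>\<sigma>\<bar> = 1" "0 \<le> \<sigma> * fst p" "0 \<le> \<sigma> * fst (p + h)"
  shows "f (p + h) = f p + branch \<sigma> h"
proof -
  have "\<bar>fst p\<bar> = \<sigma> * fst p" "\<bar>fst (p + h)\<bar> = \<sigma> * fst (p + h)"
    using assms by (metis abs_mult abs_of_nonneg mult_1)+
  thus ?thesis by (cases p, cases h) (simp add: f_eq branch_def algebra_simps)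
qed

text \<open>The height changes (l + m) |x| by at most m |x|, which leaves a horizontal stretching by
  \<open>l\<close>; the new height has modulus l m |x|, so the slope bound \<open>m\<close> is
  reproduced.\<close>

lemma branch_unstable_cone:
  assumes "\<bar>\<sigma>\<bar> = 1" "v \<in> unstable_cone"
  shows "branch \<sigma> v \<in> unstable_cone" "l * \<bar>fst v\<bar> \<le> \<bar>fst (branch \<sigma> v)\<bar>"
proof -
  obtain x y where v: "v = (x, y)" by fastforce
  have y: "\<bar>y\<bar> \<le> m * \<bar>x\<bar>" using assms by (simp add: unstable_cone_def v)
  have "\<bar>(l + m) * \<sigma> * x\<bar> = (l + m) * \<bar>x\<bar>" using assms(1) l_pos m_pos by (simp add: abs_mult)
  hence x: "l * \<bar>x\<bar> \<le> \<bar>y - (l + m) * \<sigma> * x\<bar>" using y by (simp add: algebra_simps; linarith?)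
  thus "l * \<bar>fst v\<bar> \<le> \<bar>fst (branch \<sigma> v)\<bar>" by (simp add: branch_def v)
  have "m * (l * \<bar>x\<bar>) \<le> m * \<bar>y - (l + m) * \<sigma> * x\<bar>" using x m_pos by (intro mult_left_mono) auto
  thus "branch \<sigma> v \<in> unstable_cone"
    using l_pos m_pos by (simp add: unstable_cone_def branch_def v abs_mult mult_ac)
qed

text \<open>Off the y-axis the first \<open>n\<close> steps are affine near \<open>q\<close>. The
  strict bounds on \<open>s\<close> place the point on the stable line and its image in x > 0, so
  that all later iterates stay off the axis too.\<close>

definition homoclinic_at :: "nat \<Rightarrow> real \<times> real \<Rightarrow> bool" where
  "homoclinic_at n q \<longleftrightarrow> (\<forall>j<n. fst ((f ^^ j) q) \<noteq> 0) \<and>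
     (\<exists>s. (f ^^ n) q = pt s 0 \<and> - c < s \<and> m * s < c)"

lemma homoclinic_at_shift:
  assumes "homoclinic_at n (f q)" "fst q \<noteq> 0"
  shows "homoclinic_at (Suc n) q"
  using assms unfolding homoclinic_at_def less_Suc_eq_0_disj
  by (auto simp: funpow_Suc_right simp del: funpow.simps(2))

text \<open>The sign at the midpoint decides: a point of opposite sign would force a zero between it
  and the midpoint, inside the open segment. An end point may lie on the axis.\<close>

lemma one_sided:
  assumes "\<And>t. t \<in> {0<..<1} \<Longrightarrow> fst (p + t *\<^sub>R v) \<noteq> 0"
  obtains \<sigma> :: real where "\<bar>\<sigma>\<bar> = 1" "\<And>t. t \<in> {0..1} \<Longrightarrow> 0 \<le> \<sigma> * fst (p + t *\<^sub>R v)"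
proof -
  define \<sigma> where "\<sigma> = sgn (fst (p + (1/2) *\<^sub>R v))"
  have nz: "fst (p + (1/2) *\<^sub>R v) \<noteq> 0" using assms[of "1/2"] by simp
  hence 1: "\<bar>\<sigma>\<bar> = 1" by (simp add: \<sigma>_def abs_sgn_eq)
  have pos: "0 < \<sigma> * fst (p + (1/2) *\<^sub>R v)" using nz by (simp only: \<sigma>_def sgn_if) (auto split: if_splits)
  have "0 \<le> \<sigma> * fst (p + t *\<^sub>R v)" if t: "t \<in> {0..1}" for t
  proof (rule ccontr)
    define g where "g = (\<lambda>t. \<sigma> * fst (p + t *\<^sub>R v))"
    define \<theta> where "\<theta> = g t / (g t - g (1/2))"
    assume "\<not> 0 \<le> \<sigma> * fst (p + t *\<^sub>R v)"
    hence gt: "g t < 0" by (simp add: g_def)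
    have gh: "0 < g (1/2)" using pos by (simp add: g_def)
    have \<theta>: "0 < \<theta>" "\<theta> < 1" using gt gh by (auto simp: \<theta>_def divide_simps)
    define t' where "t' = t + \<theta> * (1/2 - t)"
    have "g t' = g t + \<theta> * (g (1/2) - g t)"
      by (simp add: g_def t'_def algebra_simps)
    also have "\<theta> * (g (1/2) - g t) = - g t" using gt gh by (simp add: \<theta>_def field_simps)
    finally have "fst (p + t' *\<^sub>R v) = 0" using 1 by (auto simp: g_def)
    moreover have "t' \<in> {0<..<1}"
    proof -
      define k where "k = (1 - \<theta>) * t"
      have "t' = k + \<theta> / 2" by (simp add: t'_def k_def algebra_simps)
      moreover have "0 \<le> k" "k \<le> 1 - \<theta>" unfolding k_def
        using t \<theta> by (intro mult_nonneg_nonneg mult_left_le; simp)+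
      ultimately show ?thesis using \<theta> unfolding greaterThanLessThan_iff by (intro conjI) linarith+
    qed
    ultimately show False using assms by blast
  qed
  thus ?thesis using that 1 by blast
qed

text \<open>The image of a piece that starts on the \<open>y\<close>-axis starts on the \<open>x\<close>-axis to the
  right of the stable line of the saddle; if it comes back to the \<open>y\<close>-axis, it has crossed that line.\<close>

lemma homoclinic_of_return:
  assumes r: "(0, y0) \<in> W" and w: "w \<in> unstable_cone" "fst w \<noteq> 0" "\<bar>\<sigma>\<bar> = 1" "0 \<le> \<sigma> * fst w"
    and t1: "0 < t1" "t1 < 1" "f (0, y0) + t1 *\<^sub>R branch \<sigma> w \<in> W" "fst (f (0, y0) + t1 *\<^sub>R branch \<sigma> w) = 0"
  obtains t where "0 < t" "t < 1" "homoclinic_at 1 ((0, y0) + t *\<^sub>R w)"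
proof -
  have lc: "l * c * (1 + m) = l / (1 + l)" using l_pos m_pos by (simp add: c_def)
  define z where "z = f (0, y0)"
  have z: "z = (1 + y0, 0)" by (simp add: z_def f_eq)
  \<comment> \<open>The u-coordinate along the image segment, whose zero is the crossing with the
    stable line. By \<open>W_critical_line\<close> it is positive at the start on the x-axis and
    negative at the return to the y-axis.\<close>
  define g where "g = (\<lambda>t. u_coord (z + t *\<^sub>R branch \<sigma> w))"
  have lin: "g t = g 0 + t * (g t1 - g 0) / t1" for t
  proof -
    define d where "d = (l * fst (branch \<sigma> w) - snd (branch \<sigma> w)) / (l - m)"
    have "g t = u_coord z + t * d" for t
      by (simp add: g_def u_coord_def d_def add_divide_distrib[symmetric] algebra_simps)
    thus ?thesis using t1 by simp
  qed
  have "l * c * (1 + m) = 1 - c * (1 + m)" using c_eq by (simp add: algebra_simps)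
  hence "l * (y0 + l / (1 + l)) = l * (y0 + (1 - c * (1 + m)))" unfolding lc by simp
  hence "l * (1 + y0 - c) - l * m * c = l * (y0 + l / (1 + l))" by (simp add: algebra_simps)
  hence g0: "0 < g 0" using W_critical_line(1)[OF r] l_pos m_less_l
    by (simp add: g_def u_coord_def z)
  define y1 where "y1 = snd (z + t1 *\<^sub>R branch \<sigma> w)"
  have p1: "z + t1 *\<^sub>R branch \<sigma> w = (0, y1)" using t1(4) by (simp add: y1_def z_def prod_eq_iff)
  have y1: "- l / (1 + l) < y1" using W_critical_line(1)[of y1] t1(3) p1 by (simp add: z_def)
  have "l * (0 - c) - (y1 + l * m * c) = - (y1 + l / (1 + l))"
    unfolding lc[symmetric] by (simp add: algebra_simps)
  hence "g t1 = - (y1 + l / (1 + l)) / (l - m)" unfolding g_def p1 u_coord_def by simp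
  hence g1: "g t1 < 0" using y1 m_less_l by (simp add: divide_neg_pos)
  define t where "t = t1 * (g 0 / (g 0 - g t1))"
  have frac: "0 < g 0 / (g 0 - g t1)" "g 0 / (g 0 - g t1) < 1" using g0 g1 by auto
  have t: "0 < t" "t < t1"
    using mult_strict_left_mono[OF frac(1) t1(1)] mult_strict_left_mono[OF frac(2) t1(1)]
    by (simp_all only: t_def mult_zero_right mult_1_right)
  have "g t = 0" using lin[of t] g0 g1 t1 by (simp add: t_def field_simps)
  define q where "q = z + t *\<^sub>R branch \<sigma> w"
  define s where "s = s_coord q"
  have q_pt: "q = pt s 0" using pt_coords[of q] \<open>g t = 0\<close> by (simp add: s_def g_def q_def)
  have cone: "branch \<sigma> w \<in> unstable_cone" using branch_unstable_cone(1) w by blast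
  define \<theta> where "\<theta> = t / t1"
  have \<theta>: "0 < \<theta>" "\<theta> < 1" using t t1 by (auto simp: \<theta>_def)
  have x_eq: "t1 * fst (branch \<sigma> w) = - (1 + y0)" using t1(4) by (simp add: z_def[symmetric] z)
  have y0: "0 < 1 + y0" using W_critical_line(1)[OF r] l_pos
    by (smt (verit) divide_le_eq_1_pos divide_minus_left)
  have "fst q = 1 + y0 + \<theta> * (t1 * fst (branch \<sigma> w))" using t1 by (simp add: q_def z \<theta>_def)
  hence fq: "fst q = (1 - \<theta>) * (1 + y0)" unfolding x_eq by (simp add: algebra_simps)
  have s1: "- c < s"
  proof -
    have "0 < fst q" unfolding fq using \<theta> y0 by simp
    thus ?thesis by (simp add: q_pt)
  qed
  have s2: "m * s < c"
  proof -
    have "snd q \<le> t * \<bar>snd (branch \<sigma> w)\<bar>" using t abs_ge_self[of "snd (branch \<sigma> w)"] by (simp add: q_def z)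
    also have "\<dots> \<le> t * (m * \<bar>fst (branch \<sigma> w)\<bar>)"
      using cone t by (intro mult_left_mono) (auto simp: unstable_cone_def)
    also have "\<dots> = m * (\<theta> * \<bar>t1 * fst (branch \<sigma> w)\<bar>)" using t1 by (simp add: \<theta>_def abs_mult)
    also have "\<dots> = m * (1 + y0 - fst q)" unfolding x_eq fq using y0 by (simp add: algebra_simps)
    finally have "(l + m) * s \<le> m * (1 + y0 + (l - 1) * c)"
      by (simp add: q_pt pt_def algebra_simps)
    also have "\<dots> \<le> m * (1 / (1 - m) + (l - 1) * c)"
    proof -
      have "1 + m / (1 - m) = 1 / (1 - m)" using m_less by (simp add: field_simps)
      thus ?thesis using W_critical_line(2)[OF r] m_pos by (intro mult_left_mono) auto
    qed
    finally have "m * ((l + m) * s) \<le> m * (m * (1 / (1 - m) + (l - 1) * c))"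
      using m_pos by (intro mult_left_mono) auto
    also have "\<dots> < (l + m) * c"
    proof -
      have "m * m * ((1 + l) * (1 + m) / (1 - m)) \<le> m / 2 * ((1 + l) * 3)"
      proof -
        have "(1 + m) / (1 - m) \<le> 3" using m_less by (simp add: pos_divide_le_eq)
        hence "(1 + l) * ((1 + m) / (1 - m)) \<le> (1 + l) * 3" using l_pos by (intro mult_left_mono) auto
        moreover have "m * m \<le> m / 2" using m_less m_pos mult_left_mono[of m "1/2" m] by simp
        ultimately have "m * m * ((1 + l) * ((1 + m) / (1 - m))) \<le> m / 2 * ((1 + l) * 3)"
          using l_pos m_pos m_less by (intro mult_mono[of "m * m"]) auto
        thus ?thesis by (simp only: times_divide_eq_right)
      qed
      moreover have "m * m * (l - 1) \<le> m / 2 * (l - 1)"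
        using m_less m_pos l_gt mult_left_mono[of m "1/2" m] by (intro mult_right_mono) auto
      moreover have "m * (1 + 2 * l) < m + l" using m_less l_pos mult_strict_right_mono[of m "1/2" "2*l"]
        by (simp add: algebra_simps)
      ultimately have "m * m * ((1 + l) * (1 + m) / (1 - m)) + m * m * (l - 1) < l + m"
        by (simp add: algebra_simps)
      hence "c * (m * m * ((1 + l) * (1 + m) / (1 - m)) + m * m * (l - 1)) < c * (l + m)"
        using c_pos by (intro mult_strict_left_mono)
      moreover have "c * (m * m * ((1 + l) * (1 + m) / (1 - m))) = m * m * (1 / (1 - m))"
        using c_eq by (metis mult.commute mult.left_commute times_divide_eq_right)
      moreover have "m * (m * (K + (l - 1) * c)) = m * m * K + c * (m * m * (l - 1))" for K
        by (simp add: algebra_simps)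
      ultimately show ?thesis by (simp only: distrib_left mult.commute[of "l + m" c])
    qed
    finally have "(l + m) * (m * s) < (l + m) * c" by (simp add: mult_ac)
    thus ?thesis using l_pos m_pos by (subst (asm) mult_less_cancel_left_pos) auto
  qed
  have fq2: "f ((0, y0) + t *\<^sub>R w) = q"
  proof -
    have "f ((0, y0) + t *\<^sub>R w) = f (0, y0) + branch \<sigma> (t *\<^sub>R w)"
    proof (rule f_add)
      have "t * (\<sigma> * fst w) \<ge> 0" using w t by simp
      thus "0 \<le> \<sigma> * fst ((0, y0) + t *\<^sub>R w)" by (simp add: mult_ac)
    qed (use w in auto)
    thus ?thesis by (simp add: q_def z_def linear_cmul[OF linear_branch])
  qed
  have "homoclinic_at 1 ((0, y0) + t *\<^sub>R w)"
    unfolding homoclinic_at_def using fq2 q_pt s1 s2 w t by (auto simp: mult_ac)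
  thus ?thesis using that[of t] t t1 by auto
qed

definition W_segment :: "real \<times> real \<Rightarrow> real \<times> real \<Rightarrow> bool" where
  "W_segment p v \<longleftrightarrow> v \<in> unstable_cone \<and> fst v \<noteq> 0 \<and> (\<forall>t\<in>{0<..<1}. p + t *\<^sub>R v \<in> W)"

text \<open>The interior points at the parameters 1/4 and 3/4 lie in \<open>T\<close>, so half of
  the width is at most \<open>2 * bnd\<close>.\<close>

lemma W_segment_bound:
  assumes "W_segment p v" shows "\<bar>fst v\<bar> \<le> 4 * bnd"
proof -
  have "p + (1/4) *\<^sub>R v \<in> T" "p + (3/4) *\<^sub>R v \<in> T"
    using assms W_subset_T by (auto simp: W_segment_def)
  hence "\<bar>fst (p + (1/4) *\<^sub>R v)\<bar> \<le> bnd" "\<bar>fst (p + (3/4) *\<^sub>R v)\<bar> \<le> bnd"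
    using T_fst_bound by blast+
  thus ?thesis by simp
qed

lemma W_segment_image:
  assumes "W_segment p v" "\<bar>\<sigma>\<bar> = 1" "\<And>t. t \<in> {0..1} \<Longrightarrow> 0 \<le> \<sigma> * fst (p + t *\<^sub>R v)"
  shows "W_segment (f p) (branch \<sigma> v)" "l * \<bar>fst v\<bar> \<le> \<bar>fst (branch \<sigma> v)\<bar>"
    "\<And>t. t \<in> {0..1} \<Longrightarrow> f (p + t *\<^sub>R v) = f p + t *\<^sub>R branch \<sigma> v"
proof -
  show eq: "f (p + t *\<^sub>R v) = f p + t *\<^sub>R branch \<sigma> v" if "t \<in> {0..1}" for t
    using f_add[of \<sigma> p "t *\<^sub>R v"] assms(2) assms(3)[of 0] assms(3)[OF that]
    by (simp add: linear_cmul[OF linear_branch])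
  show len: "l * \<bar>fst v\<bar> \<le> \<bar>fst (branch \<sigma> v)\<bar>"
    using branch_unstable_cone(2) assms by (simp add: W_segment_def)
  show "W_segment (f p) (branch \<sigma> v)" unfolding W_segment_def
  proof (intro conjI ballI)
    show "branch \<sigma> v \<in> unstable_cone" using branch_unstable_cone(1) assms by (simp add: W_segment_def)
    have "0 < l * \<bar>fst v\<bar>" using assms(1) l_pos by (simp add: W_segment_def)
    thus "fst (branch \<sigma> v) \<noteq> 0" using len by auto
    fix t :: real assume t: "t \<in> {0<..<1}"
    hence "f (p + t *\<^sub>R v) \<in> W" using assms(1) f_W_subset by (simp add: W_segment_def)
    thus "f p + t *\<^sub>R branch \<sigma> v \<in> W" using eq[of t] t by auto
  qed
qed

lemma W_segment_sub:
  assumes "W_segment p v" "0 \<le> a" "a \<le> 1" "0 \<le> b" "b \<le> 1" "a \<noteq> b"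
  shows "W_segment (p + a *\<^sub>R v) ((b - a) *\<^sub>R v)"
    "t \<in> {0<..<1} \<Longrightarrow> a + t * (b - a) \<in> {0<..<1}"
proof -
  show t: "a + t * (b - a) \<in> {0<..<1}" if "t \<in> {0<..<1}" for t
  proof -
    have t: "0 < t" "t < 1" using that by auto
    show ?thesis
    proof (cases "a < b")
      case True
      have "t * (b - a) < 1 * (b - a)" "0 < t * (b - a)"
        using True t by (auto intro!: mult_strict_right_mono)
      thus ?thesis using assms by auto
    next
      case False
      hence "t * (a - b) < 1 * (a - b)" "0 < t * (a - b)"
        using assms t by (auto intro!: mult_strict_right_mono)
      moreover have "t * (b - a) = - (t * (a - b))" by (simp add: algebra_simps)
      ultimately show ?thesis using assms by auto
    qed
  qed
  show "W_segment (p + a *\<^sub>R v) ((b - a) *\<^sub>R v)" unfolding W_segment_def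
  proof (intro conjI ballI)
    show "(b - a) *\<^sub>R v \<in> unstable_cone" "fst ((b - a) *\<^sub>R v) \<noteq> 0"
      using assms mult_left_mono[of "\<bar>snd v\<bar>" "m * \<bar>fst v\<bar>" "\<bar>b - a\<bar>"]
      by (auto simp: W_segment_def unstable_cone_def abs_mult mult_ac)
    fix t :: real assume "t \<in> {0<..<1}"
    hence "p + (a + t * (b - a)) *\<^sub>R v \<in> W" using t assms(1) by (simp add: W_segment_def)
    thus "p + a *\<^sub>R v + t *\<^sub>R (b - a) *\<^sub>R v \<in> W" by (simp add: algebra_simps)
  qed
qed

text \<open>A segment that misses the y-axis is stretched by l >= l^2/2, as l < 2. Otherwise the
  longer piece on one side of the crossing is kept. If its image comes back to the axis, there is a
  homoclinic point; if not, two steps stretch this piece, at least half of the segment, by l^2. The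
  last clause carries homoclinic points found later back to the original segment.\<close>

lemma W_segment_grows_or_homoclinic:
  assumes seg: "W_segment p v"
  obtains (homoclinic) t n where "t \<in> {0<..<1}" "homoclinic_at n (p + t *\<^sub>R v)"
  | (longer) p' v' where "W_segment p' v'" "l\<^sup>2 / 2 * \<bar>fst v\<bar> \<le> \<bar>fst v'\<bar>"
      "\<And>t n. t \<in> {0<..<1} \<Longrightarrow> homoclinic_at n (p' + t *\<^sub>R v') \<Longrightarrow>
         \<exists>t'\<in>{0<..<1}. \<exists>n'. homoclinic_at n' (p + t' *\<^sub>R v)"
proof (cases "\<exists>t\<in>{0<..<1}. fst (p + t *\<^sub>R v) = 0")
  case False
  then obtain \<sigma> :: real where \<sigma>: "\<bar>\<sigma>\<bar> = 1" "\<And>t. t \<in> {0..1} \<Longrightarrow> 0 \<le> \<sigma> * fst (p + t *\<^sub>R v)"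
    using one_sided[of p v] by blast
  note im = W_segment_image[OF seg \<sigma>]
  show ?thesis
  proof (rule longer[OF im(1)])
    have "l * l \<le> 2 * l" using l_pos l_less by (intro mult_right_mono) auto
    hence "l\<^sup>2 / 2 * \<bar>fst v\<bar> \<le> l * \<bar>fst v\<bar>" by (intro mult_right_mono) (auto simp: power2_eq_square)
    thus "l\<^sup>2 / 2 * \<bar>fst v\<bar> \<le> \<bar>fst (branch \<sigma> v)\<bar>" using im(2) by linarith
    fix t :: real and n assume t: "t \<in> {0<..<1}" "homoclinic_at n (f p + t *\<^sub>R branch \<sigma> v)"
    have "homoclinic_at (Suc n) (p + t *\<^sub>R v)"
      using t im(3)[of t] False by (intro homoclinic_at_shift) auto
    thus "\<exists>t'\<in>{0<..<1}. \<exists>n'. homoclinic_at n' (p + t' *\<^sub>R v)" using t by blast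
  qed
next
  case True
  then obtain t0 where t0: "t0 \<in> {0<..<1}" "fst (p + t0 *\<^sub>R v) = 0" by blast
  define y0 where "y0 = snd (p + t0 *\<^sub>R v)"
  have r: "p + t0 *\<^sub>R v = (0, y0)" using t0 by (simp add: y0_def prod_eq_iff)
  have rW: "(0, y0) \<in> W" unfolding r[symmetric] using seg t0 by (simp add: W_segment_def)
  \<comment> \<open>The end point farther from the crossing, so that at least half of the segment
    remains.\<close>
  define b :: real where "b = (if t0 \<le> 1/2 then 1 else 0)"
  have b: "0 \<le> b" "b \<le> 1" "t0 \<noteq> b" "1/2 \<le> \<bar>b - t0\<bar>" using t0 by (auto simp: b_def)
  define w where "w = (b - t0) *\<^sub>R v"
  have sub: "W_segment (0, y0) w" "\<And>t. t \<in> {0<..<1} \<Longrightarrow> t0 + t * (b - t0) \<in> {0<..<1}"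
    using W_segment_sub[OF seg, of t0 b] b t0 r by (auto simp: w_def)
  have sub_eq: "(0, y0) + t *\<^sub>R w = p + (t0 + t * (b - t0)) *\<^sub>R v" for t
    unfolding r[symmetric] w_def by (simp add: algebra_simps)
  define \<sigma> where "\<sigma> = sgn (fst w)"
  have w0: "fst w \<noteq> 0" "w \<in> unstable_cone" using sub(1) by (auto simp: W_segment_def)
  have \<sigma>: "\<bar>\<sigma>\<bar> = 1" "0 \<le> \<sigma> * fst w" using w0 by (auto simp: \<sigma>_def abs_sgn_eq sgn_if)
  have side: "0 \<le> \<sigma> * fst ((0, y0) + t *\<^sub>R w)" if "t \<in> {0..1}" for t
    using \<sigma>(2) that mult_nonneg_nonneg[of t "\<sigma> * fst w"] by (simp add: mult_ac)
  note im = W_segment_image[OF sub(1) \<sigma>(1) side]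
  show ?thesis
  proof (cases "\<exists>t\<in>{0<..<1}. fst (f (0, y0) + t *\<^sub>R branch \<sigma> w) = 0")
    case True
    then obtain t1 where t1: "t1 \<in> {0<..<1}" "fst (f (0, y0) + t1 *\<^sub>R branch \<sigma> w) = 0" by blast
    have "f (0, y0) + t1 *\<^sub>R branch \<sigma> w \<in> W" using im(1) t1 by (simp add: W_segment_def)
    then obtain t where "0 < t" "t < 1" "homoclinic_at 1 ((0, y0) + t *\<^sub>R w)"
      using homoclinic_of_return[OF rW w0(2,1) \<sigma>] t1 by auto
    thus ?thesis using homoclinic sub(2)[of t] sub_eq[of t] by auto
  next
    case False
    then obtain \<tau> :: real where \<tau>: "\<bar>\<tau>\<bar> = 1"
      "\<And>t. t \<in> {0..1} \<Longrightarrow> 0 \<le> \<tau> * fst (f (0, y0) + t *\<^sub>R branch \<sigma> w)"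
      using one_sided[of "f (0, y0)" "branch \<sigma> w"] by blast
    note im2 = W_segment_image[OF im(1) \<tau>]
    show ?thesis
    proof (rule longer[OF im2(1)])
      have "1/2 * \<bar>fst v\<bar> \<le> \<bar>fst w\<bar>" unfolding w_def fst_scaleR real_scaleR_def abs_mult
        using b by (intro mult_right_mono) auto
      hence "l * l * (1/2 * \<bar>fst v\<bar>) \<le> l * l * \<bar>fst w\<bar>" using l_pos by (intro mult_left_mono) auto
      also have "\<dots> \<le> l * \<bar>fst (branch \<sigma> w)\<bar>" unfolding mult.assoc
        using im(2) l_pos by (intro mult_left_mono) auto
      also have "\<dots> \<le> \<bar>fst (branch \<tau> (branch \<sigma> w))\<bar>" using im2(2) .
      finally show "l\<^sup>2 / 2 * \<bar>fst v\<bar> \<le> \<bar>fst (branch \<tau> (branch \<sigma> w))\<bar>" by (simp add: power2_eq_square)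
      fix t :: real and n assume t: "t \<in> {0<..<1}" "homoclinic_at n (f (f (0, y0)) + t *\<^sub>R branch \<tau> (branch \<sigma> w))"
      have "homoclinic_at (Suc n) (f (0, y0) + t *\<^sub>R branch \<sigma> w)"
        using t im2(3)[of t] False by (intro homoclinic_at_shift) auto
      hence "homoclinic_at (Suc (Suc n)) ((0, y0) + t *\<^sub>R w)"
      proof (intro homoclinic_at_shift[of "Suc n"])
        show "homoclinic_at (Suc n) (f ((0, y0) + t *\<^sub>R w))"
          using im(3)[of t] t(1) \<open>homoclinic_at (Suc n) (f (0, y0) + t *\<^sub>R branch \<sigma> w)\<close> by auto
      qed (use t w0 in auto)
      thus "\<exists>t'\<in>{0<..<1}. \<exists>n'. homoclinic_at n' (p + t' *\<^sub>R v)"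
        using sub(2)[OF t(1)] sub_eq[of t] by auto
    qed
  qed
qed

text \<open>Since l^2/2 > 1, repeated growth would exceed the bound \<open>4 * bnd\<close> on the
  width of segments in \<open>W\<close>; so a homoclinic point must appear.\<close>

lemma W_segment_homoclinic:
  assumes "W_segment p v"
  obtains t n where "t \<in> {0<..<1}" "homoclinic_at n (p + t *\<^sub>R v)"
proof -
  have main: "W_segment p v \<Longrightarrow> 4 * bnd < (l\<^sup>2 / 2) ^ N * \<bar>fst v\<bar> \<Longrightarrow>
      \<exists>t\<in>{0<..<1}. \<exists>n. homoclinic_at n (p + t *\<^sub>R v)" for N p v
  proof (induction N arbitrary: p v)
    case 0
    thus ?case using W_segment_bound[of p v] by simp
  next
    case (Suc N)
    show ?case
    proof (cases rule: W_segment_grows_or_homoclinic[OF Suc.prems(1), case_names homoclinic longer])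
      case (longer p' v')
      have "(l\<^sup>2 / 2) ^ N * (l\<^sup>2 / 2 * \<bar>fst v\<bar>) \<le> (l\<^sup>2 / 2) ^ N * \<bar>fst v'\<bar>"
        using longer(2) by (intro mult_left_mono) auto
      hence "4 * bnd < (l\<^sup>2 / 2) ^ N * \<bar>fst v'\<bar>" using Suc.prems(2) by (simp add: mult_ac)
      thus ?thesis using Suc.IH[OF longer(1)] longer(3) by blast
    qed blast
  qed
  have v: "0 < \<bar>fst v\<bar>" using assms by (simp add: W_segment_def)
  obtain N where "4 * bnd / \<bar>fst v\<bar> < (l\<^sup>2 / 2) ^ N"
    using real_arch_pow[of "l\<^sup>2 / 2"] l_sq by auto
  hence "4 * bnd < (l\<^sup>2 / 2) ^ N * \<bar>fst v\<bar>" using v by (simp add: pos_divide_less_eq)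
  thus ?thesis using main[OF assms] that by blast
qed

section \<open>Affine behaviour near homoclinic points\<close>

lemma homoclinic_at_later:
  assumes "homoclinic_at n q"
  shows "homoclinic_at (n + k) q"
proof -
  obtain s where s: "(f ^^ n) q = pt s 0" "- c < s" "m * s < c" and nz: "\<And>j. j < n \<Longrightarrow> fst ((f ^^ j) q) \<noteq> 0"
    using assms by (auto simp: homoclinic_at_def)
  have range: "- c < (- m) ^ j * s \<and> m * ((- m) ^ j * s) < c" for j
  proof (induction j)
    case (Suc j)
    let ?s = "(- m) ^ j * s"
    have "- ?s < c" using Suc by linarith
    hence "m * (m * (- ?s)) < m * (m * c)" using m_pos by (intro mult_strict_left_mono)
    moreover have "m * (m * c) \<le> 1 * c" unfolding mult.assoc[symmetric]
      using m_pos m_less c_pos by (intro mult_right_mono) (auto intro: mult_le_one)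
    ultimately show ?case using Suc by (simp add: mult_ac)
  qed (use s in auto)
  have it: "(f ^^ (j + n)) q = pt ((- m) ^ j * s) 0" for j
    using funpow_pt_stable[of s j] s by (simp add: funpow_add)
  have "fst ((f ^^ j) q) \<noteq> 0" if "j < n + k" for j
  proof (cases "j < n")
    case False
    then obtain i where "j = i + n" by (metis add.commute le_Suc_ex not_less)
    thus ?thesis using it[of i] range[of i] by simp
  qed (use nz in auto)
  thus ?thesis unfolding homoclinic_at_def using it[of k] range[of k] by (auto simp: add.commute)
qed

text \<open>Waiting longer on the stable line multiplies \<open>s\<close> by powers of -m, and by
  \<open>homoclinic_at_later\<close> the extra iterates avoid the y-axis.\<close>

lemma homoclinic_near:
  assumes "homoclinic_at n q" "0 < \<delta>"
  obtains n' s where "\<forall>j<n'. fst ((f ^^ j) q) \<noteq> 0" "(f ^^ n') q = pt s 0" "\<bar>s\<bar> < \<delta>"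
proof -
  obtain s where s: "(f ^^ n) q = pt s 0" "- c < s" "m * s < c"
    using assms by (auto simp: homoclinic_at_def)
  have "(\<lambda>k. (- m) ^ k * s) \<longlonglongrightarrow> 0 * s"
    using m_pos m_less by (intro tendsto_intros LIMSEQ_power_zero) auto
  hence "eventually (\<lambda>k. \<bar>(- m) ^ k * s\<bar> < \<delta>) sequentially"
    using tendstoD[of "\<lambda>k. (- m) ^ k * s" 0 sequentially \<delta>] assms(2) by (simp add: dist_real_def)
  then obtain k where k: "\<bar>(- m) ^ k * s\<bar> < \<delta>" by (auto simp: eventually_sequentially)
  have "(f ^^ (k + n)) q = pt ((- m) ^ k * s) 0"
    using funpow_pt_stable[of s k] s by (simp add: funpow_add)
  thus ?thesis using that[of "k + n" "(- m) ^ k * s"] k homoclinic_at_later[OF assms(1), of k]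
    by (auto simp: homoclinic_at_def add.commute)
qed

text \<open>No iterate involved lies on the y-axis, so on a small ball around \<open>q\<close> each
  step acts through one fixed branch; the cone estimates pass to the product of the
  branches.\<close>

lemma locally_affine:
  assumes "\<forall>j<n. fst ((f ^^ j) q) \<noteq> 0"
  obtains M r where "linear M" "0 < r" "\<And>h. norm h < r \<Longrightarrow> (f ^^ n) (q + h) = (f ^^ n) q + M h"
    "\<And>v. v \<in> unstable_cone \<Longrightarrow> M v \<in> unstable_cone"
    "\<And>v. v \<in> unstable_cone \<Longrightarrow> \<bar>fst v\<bar> \<le> \<bar>fst (M v)\<bar>"
  using assms
proof (induction n arbitrary: thesis)
  case 0
  show ?case by (rule 0(1)[of id 1]) (auto simp: linear_id[unfolded id_def] id_def)
next
  case (Suc n)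
  obtain M r where M: "linear M" "0 < r" "\<And>h. norm h < r \<Longrightarrow> (f ^^ n) (q + h) = (f ^^ n) q + M h"
    "\<And>v. v \<in> unstable_cone \<Longrightarrow> M v \<in> unstable_cone"
    "\<And>v. v \<in> unstable_cone \<Longrightarrow> \<bar>fst v\<bar> \<le> \<bar>fst (M v)\<bar>"
    using Suc.IH Suc.prems(2) by (metis less_SucI)
  define p where "p = (f ^^ n) q"
  have p: "fst p \<noteq> 0" using Suc.prems(2) by (simp add: p_def)
  define \<sigma> where "\<sigma> = sgn (fst p)"
  have \<sigma>: "\<bar>\<sigma>\<bar> = 1" "\<sigma> * fst p = \<bar>fst p\<bar>" using p by (auto simp: \<sigma>_def abs_sgn_eq sgn_if)
  obtain B where B: "0 < B" "\<And>h. norm (M h) \<le> B * norm h"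
    using linear_bounded_pos[OF M(1)] by blast
  show ?case
  \<comment> \<open>The radius keeps |fst (M h)| below |fst p|, so that \<open>p + M h\<close> stays
    on the same side of the axis as \<open>p\<close>.\<close>
  proof (rule Suc.prems(1)[of "branch \<sigma> \<circ> M" "min r (\<bar>fst p\<bar> / B)"])
    show "linear (branch \<sigma> \<circ> M)" by (rule linear_compose[OF M(1) linear_branch])
    show "0 < min r (\<bar>fst p\<bar> / B)" using M B p by simp
    fix h :: "real \<times> real" assume h: "norm h < min r (\<bar>fst p\<bar> / B)"
    have "\<bar>fst (M h)\<bar> \<le> norm (M h)" by (metis norm_fst_le real_norm_def prod.collapse)
    also have "\<dots> \<le> B * norm h" by (rule B)
    also have "\<dots> < \<bar>fst p\<bar>" using h B by (simp add: pos_less_divide_eq mult.commute)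
    finally have small: "\<bar>fst (M h)\<bar> < \<bar>fst p\<bar>" .
    have "\<bar>\<sigma> * fst (M h)\<bar> < \<bar>fst p\<bar>" using small \<sigma> by (simp add: abs_mult)
    hence "f (p + M h) = f p + branch \<sigma> (M h)" using \<sigma> by (intro f_add) (auto simp: algebra_simps)
    thus "(f ^^ Suc n) (q + h) = (f ^^ Suc n) q + (branch \<sigma> \<circ> M) h"
      using M(3)[of h] h by (simp add: p_def)
  next
    fix v assume v: "v \<in> unstable_cone"
    show "(branch \<sigma> \<circ> M) v \<in> unstable_cone" using branch_unstable_cone(1)[OF \<sigma>(1)] M(4)[OF v] by simp
    have "1 * \<bar>fst (M v)\<bar> \<le> l * \<bar>fst (M v)\<bar>" using l_gt by (intro mult_right_mono) auto
    thus "\<bar>fst v\<bar> \<le> \<bar>fst ((branch \<sigma> \<circ> M) v)\<bar>" using branch_unstable_cone(2)[OF \<sigma>(1) M(4)[OF v]] M(5)[OF v] by simp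
  qed
qed

subsection \<open>Transitivity\<close>

definition es :: "real \<times> real" where "es = (1, l)"
definition eu :: "real \<times> real" where "eu = (1, m)"

definition S_lin :: "real \<times> real \<Rightarrow> real" where "S_lin h = (snd h - m * fst h) / (l - m)"
definition U_lin :: "real \<times> real \<Rightarrow> real" where "U_lin h = (l * fst h - snd h) / (l - m)"

lemma eigen_decomp: "h = S_lin h *\<^sub>R es + U_lin h *\<^sub>R eu"
proof -
  have "snd h - m * fst h + (l * fst h - snd h) = fst h * (l - m)"
    "(snd h - m * fst h) * l + (l * fst h - snd h) * m = snd h * (l - m)"
    by (simp_all add: algebra_simps)
  thus ?thesis using m_less_l
    by (simp add: S_lin_def U_lin_def es_def eu_def prod_eq_iff add_divide_distrib[symmetric])
qed

lemma pt_add: "pt s u + h = pt (s + S_lin h) (u + U_lin h)"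
proof -
  have "pt s u + (x *\<^sub>R es + y *\<^sub>R eu) = pt (s + x) (u + y)" for x y
    by (simp add: pt_def es_def eu_def algebra_simps)
  thus ?thesis using eigen_decomp[of h] by metis
qed

lemma linear_S_lin: "linear S_lin" and linear_U_lin: "linear U_lin"
  unfolding S_lin_def U_lin_def
  by (auto intro!: linearI simp: add_divide_distrib[symmetric] diff_divide_distrib[symmetric] algebra_simps)

lemma lin_eigen [simp]: "S_lin es = 1" "S_lin eu = 0" "U_lin es = 0" "U_lin eu = 1"
  using m_less_l by (auto simp: S_lin_def U_lin_def es_def eu_def)

lemma U_lin_cone:
  assumes "h \<in> unstable_cone" "fst h \<noteq> 0"
  shows "U_lin h \<noteq> 0"
proof
  assume "U_lin h = 0"
  hence "snd h = l * fst h" using m_less_l by (simp add: U_lin_def)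
  hence "l * \<bar>fst h\<bar> \<le> m * \<bar>fst h\<bar>" using assms(1) l_pos by (simp add: unstable_cone_def abs_mult)
  thus False using assms(2) m_less_l by (simp add: mult_le_cancel_right)
qed

lemma eu_cone: "eu \<in> unstable_cone" using m_pos by (simp add: eu_def unstable_cone_def)

text \<open>An affine inclination lemma. At a homoclinic point the image of the segment crosses the
  stable line transversally; further iterates contract the s-direction and stretch the u-direction,
  so the images accumulate on the local unstable segment and, after \<open>j\<close> more steps, on
  \<open>w\<close>. As the waiting time \<open>k\<close> is free, this works for all large
  \<open>N\<close>.\<close>

lemma iterates_accumulate_on_W:
  assumes seg: "W_segment p v" and w: "w \<in> W" and "0 < \<delta>"
  obtains N0 where "\<And>N. N0 \<le> N \<Longrightarrow> \<exists>t\<in>{0<..<1}. dist ((f ^^ N) (p + t *\<^sub>R v)) w < \<delta>"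
proof -
  obtain t0 n0 where t0: "t0 \<in> {0<..<1}" "homoclinic_at n0 (p + t0 *\<^sub>R v)"
    using W_segment_homoclinic[OF seg] by blast
  define q where "q = p + t0 *\<^sub>R v"
  obtain n s where n: "\<forall>j<n. fst ((f ^^ j) q) \<noteq> 0" "(f ^^ n) q = pt s 0" "\<bar>s\<bar> < c / 4"
    using homoclinic_near[OF t0(2), of "c / 4"] c_pos by (auto simp: q_def)
  obtain M r where M: "linear M" "0 < r" "\<And>h. norm h < r \<Longrightarrow> (f ^^ n) (q + h) = (f ^^ n) q + M h"
    "\<And>v. v \<in> unstable_cone \<Longrightarrow> M v \<in> unstable_cone"
    "\<And>v. v \<in> unstable_cone \<Longrightarrow> \<bar>fst v\<bar> \<le> \<bar>fst (M v)\<bar>"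
    using locally_affine[OF n(1)] by metis
  define ds du where "ds = S_lin (M v)" and "du = U_lin (M v)"
  have v: "v \<in> unstable_cone" "fst v \<noteq> 0" using seg by (auto simp: W_segment_def)
  \<comment> \<open>Cone vectors with nonzero horizontal part are not parallel to the stable
    direction, since m < l.\<close>
  have du: "du \<noteq> 0" unfolding du_def using M(4,5)[OF v(1)] v(2) by (intro U_lin_cone) auto
  obtain j u where ju: "w = (f ^^ j) (pt 0 u)" "\<bar>u\<bar> \<le> c / 4" using w by (auto simp: W_def)
  \<comment> \<open>The parameter offset for which the u-coordinate after \<open>n + k\<close> steps
    is exactly \<open>u\<close>.\<close>
  define \<tau> where "\<tau> = (\<lambda>k. u / du / (- l) ^ k)"
  have \<tau>0: "\<tau> \<longlonglongrightarrow> 0" unfolding \<tau>_def by (rule unstable_coord_tendsto_0)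
  have x_n: "(f ^^ n) (p + (t0 + \<tau> k) *\<^sub>R v) = pt (s + \<tau> k * ds) (\<tau> k * du)"
    if "norm (\<tau> k *\<^sub>R v) < r" for k
  proof -
    have "p + (t0 + \<tau> k) *\<^sub>R v = q + \<tau> k *\<^sub>R v" by (simp add: q_def algebra_simps)
    thus ?thesis using M(3)[OF that] n(2)
      by (simp add: pt_add linear_cmul[OF M(1)] linear_cmul[OF linear_S_lin] linear_cmul[OF linear_U_lin] ds_def du_def)
  qed
  have x_nk: "(f ^^ (j + (k + n))) (p + (t0 + \<tau> k) *\<^sub>R v) = (f ^^ j) (pt ((- m) ^ k * (s + \<tau> k * ds)) u)"
    if "norm (\<tau> k *\<^sub>R v) < r" "\<bar>\<tau> k * ds\<bar> < c / 4" for k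
  proof -
    have u_k: "(- l) ^ k * (\<tau> k * du) = u" using du l_pos by (simp add: \<tau>_def)
    have "\<bar>l ^ k * (\<tau> k * du)\<bar> = \<bar>(- l) ^ k * (\<tau> k * du)\<bar>" by (simp add: abs_mult power_abs)
    hence "\<bar>l ^ k * (\<tau> k * du)\<bar> \<le> c / 2" using ju(2) c_pos unfolding u_k by simp
    moreover have "\<bar>s + \<tau> k * ds\<bar> \<le> c / 2" using that n(3) by linarith
    ultimately have "(f ^^ k) (pt (s + \<tau> k * ds) (\<tau> k * du)) = pt ((- m) ^ k * (s + \<tau> k * ds)) u"
      using funpow_pt[of "s + \<tau> k * ds" k "\<tau> k * du"] u_k by simp
    thus ?thesis using x_n[OF that(1)] by (simp add: funpow_add)
  qed
  have lim: "(\<lambda>k. (f ^^ j) (pt ((- m) ^ k * (s + \<tau> k * ds)) u)) \<longlonglongrightarrow> w"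
  proof -
    have "(\<lambda>k. pt ((- m) ^ k * (s + \<tau> k * ds)) u) \<longlonglongrightarrow> pt (0 * (s + 0 * ds)) u"
      using m_pos m_less by (intro tendsto_intros \<tau>0 LIMSEQ_power_zero) auto
    from tendsto_funpow[OF this, of j] show ?thesis by (simp add: ju(1))
  qed
  have ev1: "eventually (\<lambda>k. norm (\<tau> k *\<^sub>R v) < r) sequentially"
  proof -
    have "(\<lambda>k. \<tau> k *\<^sub>R v) \<longlonglongrightarrow> 0 *\<^sub>R v" by (intro tendsto_intros \<tau>0)
    thus ?thesis using tendstoD[of "\<lambda>k. \<tau> k *\<^sub>R v" 0 sequentially r] M(2) by simp
  qed
  have ev2: "eventually (\<lambda>k. \<bar>\<tau> k * ds\<bar> < c / 4) sequentially"
  proof -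
    have "(\<lambda>k. \<tau> k * ds) \<longlonglongrightarrow> 0 * ds" by (intro tendsto_intros \<tau>0)
    thus ?thesis using tendstoD[of "\<lambda>k. \<tau> k * ds" 0 sequentially "c / 4"] c_pos by simp
  qed
  have ev3: "eventually (\<lambda>k. t0 + \<tau> k \<in> {0<..<1}) sequentially"
  proof -
    have "(\<lambda>k. t0 + \<tau> k) \<longlonglongrightarrow> t0 + 0" by (intro tendsto_intros \<tau>0)
    thus ?thesis using t0(1) by (intro topological_tendstoD[of _ t0]) auto
  qed
  have ev4: "eventually (\<lambda>k. dist ((f ^^ j) (pt ((- m) ^ k * (s + \<tau> k * ds)) u)) w < \<delta>) sequentially"
    using tendstoD[OF lim \<open>0 < \<delta>\<close>] .
  have "eventually (\<lambda>k. \<exists>t\<in>{0<..<1}. dist ((f ^^ (j + (k + n))) (p + t *\<^sub>R v)) w < \<delta>) sequentially"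
    using ev1 ev2 ev3 ev4 by eventually_elim (metis x_nk)
  then obtain K where K: "\<And>k. K \<le> k \<Longrightarrow> \<exists>t\<in>{0<..<1}. dist ((f ^^ (j + (k + n))) (p + t *\<^sub>R v)) w < \<delta>"
    by (auto simp: eventually_sequentially)
  show ?thesis
  proof (rule that[of "j + K + n"])
    fix N assume "j + K + n \<le> N"
    hence "K \<le> N - j - n" "N = j + ((N - j - n) + n)" by auto
    thus "\<exists>t\<in>{0<..<1}. dist ((f ^^ N) (p + t *\<^sub>R v)) w < \<delta>" using K by metis
  qed
qed

section \<open>The closure of the unstable manifold\<close>

definition F :: "(real \<times> real) set" where "F = closure W"

lemma W_subset_F: "W \<subseteq> F" by (simp add: F_def closure_subset)

lemma closed_F: "closed F" by (simp add: F_def)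

lemma F_subset_T: "F \<subseteq> T" unfolding F_def using closed_T W_subset_T by (rule closure_minimal[rotated])

lemma compact_F: "compact F"
  using compact_Int_closed[OF compact_T closed_F] F_subset_T by (simp add: inf.absorb2)

lemma f_image_F: "f ` F = F"
proof
  show "f ` F \<subseteq> F"
    unfolding F_def by (rule image_closure_subset[OF continuous_f closed_closure])
      (simp add: f_image_W closure_subset)
  have "closed (f ` F)" using compact_F compact_continuous_image continuous_f compact_imp_closed by blast
  moreover have "W \<subseteq> f ` F" using f_image_W W_subset_F by blast
  ultimately show "F \<subseteq> f ` F" by (simp add: F_def closure_minimal)
qed

lemma funpow_F: "p \<in> F \<Longrightarrow> (f ^^ n) p \<in> F"
proof (induction n)
  case (Suc n)
  have "f ((f ^^ n) p) \<in> f ` F" using Suc by blast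
  thus ?case by (simp add: f_image_F)
qed simp

lemma W_segment_in_open:
  assumes "open V" "V \<inter> F \<noteq> {}"
  obtains j u0 d where "W_segment (pt 0 u0) (d *\<^sub>R eu)"
    "\<And>t. t \<in> {0<..<1} \<Longrightarrow> (f ^^ j) (pt 0 u0 + t *\<^sub>R (d *\<^sub>R eu)) \<in> V"
    "\<And>t. t \<in> {0<..<1} \<Longrightarrow> \<bar>u0 + t * d\<bar> \<le> c / 4"
proof -
  have "V \<inter> W \<noteq> {}" using assms by (metis F_def inf_commute open_Int_closure_eq_empty)
  then obtain j u0 where u0: "\<bar>u0\<bar> \<le> c / 4" "(f ^^ j) (pt 0 u0) \<in> V"
    by (auto simp: W_def)
  have "continuous_on UNIV (\<lambda>u. (f ^^ j) (pt 0 u))"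
    by (rule continuous_on_compose2[OF continuous_funpow[of UNIV j]]) (intro continuous_intros, simp)
  hence "open ((\<lambda>u. (f ^^ j) (pt 0 u)) -` V)" using assms(1) by (simp add: continuous_on_open_vimage)
  moreover have "u0 \<in> (\<lambda>u. (f ^^ j) (pt 0 u)) -` V" using u0(2) by simp
  ultimately obtain \<rho> where \<rho>: "0 < \<rho>" "\<And>u. \<bar>u - u0\<bar> < \<rho> \<Longrightarrow> (f ^^ j) (pt 0 u) \<in> V"
    unfolding open_dist dist_real_def by (metis vimageD)
  define d where "d = (if 0 \<le> u0 then - min \<rho> (c / 4) else min \<rho> (c / 4))"
  have e: "pt 0 u0 + t *\<^sub>R (d *\<^sub>R eu) = pt 0 (u0 + t * d)" for t
    by (simp add: pt_add linear_cmul[OF linear_S_lin] linear_cmul[OF linear_U_lin])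
  have d0: "d \<noteq> 0" using \<rho> c_pos by (auto simp: d_def)
  have td: "\<bar>t * d\<bar> < min \<rho> (c / 4)" if "t \<in> {0<..<1}" for t
  proof -
    have "\<bar>d\<bar> = min \<rho> (c / 4)" using \<rho> c_pos by (auto simp: d_def)
    moreover have "t * \<bar>d\<bar> < 1 * \<bar>d\<bar>" using that d0 by (intro mult_strict_right_mono) auto
    ultimately show ?thesis using that by (simp add: abs_mult)
  qed
  have b: "\<bar>u0 + t * d\<bar> \<le> c / 4" if t: "t \<in> {0<..<1}" for t
  proof (cases "0 \<le> u0")
    case True
    hence "t * d \<le> 0" using t \<rho> c_pos by (auto simp: d_def mult_le_0_iff)
    thus ?thesis using True td[OF t] u0(1) by linarith
  next
    case False
    hence "0 \<le> t * d" using t \<rho> c_pos by (auto simp: d_def)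
    thus ?thesis using False td[OF t] u0(1) by linarith
  qed
  show ?thesis
  proof (rule that[of u0 d j])
    show "W_segment (pt 0 u0) (d *\<^sub>R eu)" unfolding W_segment_def e
      using b W_I d0 m_pos by (auto simp: unstable_cone_def eu_def abs_mult)
  qed (use b td \<rho>(2) e in auto)
qed

text \<open>Transitivity with arbitrarily late times, as required for an orbit whose limit set, and
  not only its closure, is all of \<open>F\<close>.\<close>

lemma transitive_late:
  assumes "open V1" "V1 \<inter> F \<noteq> {}" "open V2" "V2 \<inter> F \<noteq> {}"
  obtains N x where "n \<le> N" "x \<in> V1 \<inter> F" "(f ^^ N) x \<in> V2"
proof -
  obtain j p v where pv: "W_segment p v" "\<And>t. t \<in> {0<..<1} \<Longrightarrow> (f ^^ j) (p + t *\<^sub>R v) \<in> V1"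
    using W_segment_in_open[OF assms(1,2)] by metis
  have "V2 \<inter> W \<noteq> {}" using assms by (metis F_def inf_commute open_Int_closure_eq_empty)
  then obtain w where w: "w \<in> W" "w \<in> V2" by blast
  obtain \<delta> where \<delta>: "0 < \<delta>" "\<And>y. dist y w < \<delta> \<Longrightarrow> y \<in> V2"
    using assms(3) w(2) unfolding open_dist by metis
  obtain N0 where N0: "\<And>N. N0 \<le> N \<Longrightarrow> \<exists>t\<in>{0<..<1}. dist ((f ^^ N) (p + t *\<^sub>R v)) w < \<delta>"
    using iterates_accumulate_on_W[OF pv(1) w(1) \<delta>(1)] by blast
  obtain t where t: "t \<in> {0<..<1}" "dist ((f ^^ (n + N0 + j)) (p + t *\<^sub>R v)) w < \<delta>"
    using N0[of "n + N0 + j"] by auto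
  show ?thesis
  proof (rule that[of "n + N0" "(f ^^ j) (p + t *\<^sub>R v)"])
    have "p + t *\<^sub>R v \<in> W" using pv(1) t(1) by (simp add: W_segment_def)
    thus "(f ^^ j) (p + t *\<^sub>R v) \<in> V1 \<inter> F" using pv(2)[OF t(1)] funpow_W W_subset_F by blast
    show "(f ^^ (n + N0)) ((f ^^ j) (p + t *\<^sub>R v)) \<in> V2"
      using \<delta>(2)[OF t(2)] by (simp add: funpow_add)
  qed simp
qed

lemma transitive_F: "transitive_on F f"
  unfolding transitive_on_def
proof (intro allI impI, elim conjE)
  fix A B assume "openin (top_of_set F) A" "openin (top_of_set F) B" and ne: "A \<noteq> {}" "B \<noteq> {}"
  then obtain V1 V2 where V: "open V1" "A = F \<inter> V1" "open V2" "B = F \<inter> V2"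
    by (auto simp: openin_open)
  obtain N x where "x \<in> V1 \<inter> F" "(f ^^ N) x \<in> V2"
    using transitive_late[of V1 V2 0] V ne by blast
  thus "\<exists>i. (f ^^ i) ` A \<inter> B \<noteq> {}" using V funpow_F by blast
qed

lemma pt_fixed_in_F: "pt 0 0 \<in> F" using W_I[of 0] c_pos W_subset_F by auto

text \<open>By Baire some point of \<open>F\<close> visits every basic open set that meets
  \<open>F\<close> after every time \<open>n\<close>, and then each point of \<open>F\<close> is a
  limit point of its orbit. That each \<open>visit V n\<close> is dense in \<open>F\<close> comes
  from \<open>transitive_late\<close>.\<close>

lemma dense_orbit:
  obtains x where "x \<in> F" "omega_limit f x = F"
proof -
  obtain \<B> :: "(real \<times> real) set set" where \<B>: "countable \<B>" "topological_basis \<B>"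
    using ex_countable_basis by blast
  define visit where "visit = (\<lambda>V n. F \<inter> (\<Union>N\<in>{n..}. (f ^^ N) -` V))"
  define \<G> where "\<G> = (\<lambda>(V, n). visit V n) ` ({V \<in> \<B>. V \<inter> F \<noteq> {}} \<times> (UNIV :: nat set))"
  have "F \<subseteq> closure (\<Inter>\<G>)"
  proof (rule Baire[OF closed_F])
    show "countable \<G>" unfolding \<G>_def using \<B>(1)
      by (intro countable_image countable_SIGMA) (auto intro: countable_subset)
    fix A assume "A \<in> \<G>"
    then obtain V n where V: "V \<in> \<B>" "V \<inter> F \<noteq> {}" "A = visit V n" by (auto simp: \<G>_def)
    have oV: "open V" using V \<B>(2) topological_basis_open by blast
    have "open (\<Union>N\<in>{n..}. (f ^^ N) -` V)"
      using continuous_funpow[of UNIV] oV by (auto simp: continuous_on_open_vimage)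
    hence "openin (top_of_set F) A" by (auto simp: V(3) visit_def openin_open)
    moreover have "F \<subseteq> closure A"
    proof
      fix x assume x: "x \<in> F"
      show "x \<in> closure A"
      proof (rule closure_iff_nhds_not_empty[THEN iffD2], intro allI impI)
        fix B V' assume B: "V' \<subseteq> B" "open V'" "x \<in> V'"
        obtain N y where "n \<le> N" "y \<in> V' \<inter> F" "(f ^^ N) y \<in> V"
          using transitive_late[of V' V n] B x oV V(2) by blast
        thus "A \<inter> B \<noteq> {}" using B by (auto simp: V(3) visit_def)
      qed
    qed
    ultimately show "openin (top_of_set F) A \<and> F \<subseteq> closure A" by blast
  qed
  moreover have "F \<noteq> {}" using pt_fixed_in_F by blast
  ultimately have "\<Inter>\<G> \<noteq> {}" using closure_empty by force
  then obtain x where x: "x \<in> \<Inter>\<G>" by blast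
  \<comment> \<open>The family has to be nonempty for its intersection to lie in
    \<open>F\<close>.\<close>
  obtain V0 where "V0 \<in> \<B>" "pt 0 0 \<in> V0" using topological_basisE[OF \<B>(2) open_UNIV, of "pt 0 0"] by blast
  hence "visit V0 0 \<in> \<G>" using pt_fixed_in_F by (auto simp: \<G>_def)
  hence xF: "x \<in> F" using x by (auto simp: visit_def)
  have visits: "\<exists>N\<ge>n. dist ((f ^^ N) x) y < \<delta>" if y: "y \<in> F" and "0 < \<delta>" for y \<delta> n
  proof -
    obtain V where V: "V \<in> \<B>" "y \<in> V" "V \<subseteq> ball y \<delta>"
      using topological_basisE[OF \<B>(2) open_ball, of y y \<delta>] \<open>0 < \<delta>\<close> by auto
    hence "visit V n \<in> \<G>" using y by (auto simp: \<G>_def)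
    hence "x \<in> visit V n" using x by blast
    then obtain N where N: "n \<le> N" "(f ^^ N) x \<in> V" by (auto simp: visit_def)
    hence "(f ^^ N) x \<in> ball y \<delta>" using V(3) by blast
    hence "dist ((f ^^ N) x) y < \<delta>" by (simp add: dist_commute)
    thus ?thesis using N(1) by blast
  qed
  have "omega_limit f x = F"
  proof
    show "omega_limit f x \<subseteq> F"
    proof
      fix y assume "y \<in> omega_limit f x"
      then obtain r where "(\<lambda>n. (f ^^ r n) x) \<longlonglongrightarrow> y" by (auto simp: omega_limit_def)
      thus "y \<in> F" by (rule closed_sequentially[OF closed_F funpow_F[OF xF]])
    qed
    show "F \<subseteq> omega_limit f x"
    proof
      fix y assume y: "y \<in> F"
      have "\<exists>r. \<forall>k. dist ((f ^^ r k) x) y < inverse (real (Suc k)) \<and> r k < r (Suc k)"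
      proof (rule dependent_nat_choice)
        show "\<exists>N. dist ((f ^^ N) x) y < inverse (real (Suc 0))" using visits[OF y, of 1 0] by auto
        fix N k
        show "\<exists>N'. dist ((f ^^ N') x) y < inverse (real (Suc (Suc k))) \<and> N < N'"
          using visits[OF y, of "inverse (real (Suc (Suc k)))" "Suc N"] unfolding Suc_le_eq by auto
      qed
      then obtain r where r: "\<And>k. dist ((f ^^ r k) x) y < inverse (real (Suc k))" "\<And>k. r k < r (Suc k)"
        by blast
      have "(\<lambda>k. dist ((f ^^ r k) x) y) \<longlonglongrightarrow> 0"
      proof (rule Lim_null_comparison[OF always_eventually LIMSEQ_inverse_real_of_nat], rule allI)
        show "norm (dist ((f ^^ r k) x) y) \<le> inverse (real (Suc k))" for k using r(1)[of k] by simp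
      qed
      hence "(\<lambda>k. (f ^^ r k) x) \<longlonglongrightarrow> y" by (subst tendsto_dist_iff)
      moreover have "strict_mono r" using r(2) by (simp add: strict_mono_Suc_iff)
      ultimately show "y \<in> omega_limit f x" unfolding omega_limit_def by blast
    qed
  qed
  thus ?thesis using that xF by blast
qed

subsection \<open>Periodic points\<close>

text \<open>In the eigencoordinates, \<open>f\<^sup>k \<circ> f\<^sup>n\<close> is affine near the homoclinic point for large \<open>k\<close>.
  The slope \<open>\<kappa>\<close> of its stable direction and the height \<open>d\<close> of its invariant stable line at \<open>s = 0\<close>
  solve the hypotheses named \<open>\<kappa>\<close> and \<open>d\<close>. The line contains the fixed point \<open>s\<^sup>* = E / (1 - \<beta>)\<close> and meets \<open>W\<close> at
  \<open>s = 0\<close>, so the fixed point is a limit of points of \<open>W\<close>.\<close>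

lemma periodic_of_stable_line:
  fixes u0 s0 m11 m12 m21 m22 \<kappa> d \<beta> E \<rho> :: real
  assumes aff: "\<And>s w. \<bar>s\<bar> < \<rho> \<Longrightarrow> \<bar>w\<bar> < \<rho> \<Longrightarrow>
      (f ^^ n) (pt s (u0 + w)) = pt (s0 + m11 * s + m12 * w) (m21 * s + m22 * w)"
    and \<beta>: "\<beta> = (- m) ^ k * (m11 + m12 * \<kappa>)" "\<bar>\<beta>\<bar> \<le> 1 / 2"
    and \<kappa>: "(- l) ^ k * (m21 + m22 * \<kappa>) = \<beta> * \<kappa>"
    and E: "E = (- m) ^ k * (s0 + m12 * d)"
    and d: "(- l) ^ k * (m22 * d) = u0 + d + \<kappa> * E"
    and small: "2 * \<bar>E\<bar> < \<eta>" "\<bar>d\<bar> < \<eta>" "\<bar>\<kappa>\<bar> \<le> H" "(3 + 3 * H) * \<eta> \<le> \<rho>" "(3 + 3 * H) * \<eta> \<le> c / 4"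
      "(2 * \<bar>m11\<bar> + (3 + 3 * H) * \<bar>m12\<bar>) * \<eta> \<le> c / 4"
    and su0: "\<bar>s0\<bar> \<le> c / 4" "\<bar>u0\<bar> \<le> c / 4"
    and "0 < k"
  obtains P s w where "0 < P" "(f ^^ P) (pt s (u0 + w)) = pt s (u0 + w)" "pt s (u0 + w) \<in> F"
    "\<bar>s\<bar> \<le> \<eta>" "\<bar>w\<bar> \<le> (3 + 3 * H) * \<eta>"
proof -
  define line where "line = (\<lambda>s. pt s (u0 + (d + \<kappa> * s)))"
  have \<eta>: "0 < \<eta>" using small(1) by linarith
  have H: "0 \<le> H" using small(3) by linarith
  have \<kappa>s: "\<bar>d + \<kappa> * s\<bar> < (3 + 3 * H) * \<eta>" if "\<bar>s\<bar> \<le> 3 * \<eta>" for s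
  proof -
    have "\<bar>\<kappa> * s\<bar> \<le> H * (3 * \<eta>)" unfolding abs_mult using small(3) that H by (intro mult_mono) auto
    thus ?thesis using small(2) \<eta> by (simp add: algebra_simps; linarith?)
  qed
  \<comment> \<open>Near s = 0 the return map sends the line into itself and acts on
    \<open>s\<close> as the contraction taking s to \<beta> s + E. The estimates keep all points
    where both affine formulas hold.\<close>
  have step: "(f ^^ (k + n)) (line s) = line (\<beta> * s + E)" if s: "\<bar>s\<bar> \<le> 2 * \<eta>" for s
  proof -
    define w where "w = d + \<kappa> * s"
    have "\<bar>s\<bar> \<le> 3 * \<eta>" using s \<eta> by linarith
    hence w: "\<bar>w\<bar> < (3 + 3 * H) * \<eta>" using \<kappa>s by (simp add: w_def)
    have "2 * \<eta> < (3 + 3 * H) * \<eta>" using \<eta> H by (intro mult_strict_right_mono) auto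
    hence "\<bar>s\<bar> < \<rho>" "\<bar>w\<bar> < \<rho>" using s w small(4) by auto
    hence n: "(f ^^ n) (line s) = pt (s0 + m11 * s + m12 * w) (m21 * s + m22 * w)"
      using aff by (simp add: line_def w_def)
    have "\<bar>m11 * s\<bar> \<le> \<bar>m11\<bar> * (2 * \<eta>)" "\<bar>m12 * w\<bar> \<le> \<bar>m12\<bar> * ((3 + 3 * H) * \<eta>)"
      unfolding abs_mult using s w by (auto intro!: mult_left_mono)
    moreover have "\<bar>m11 * s + m12 * w\<bar> \<le> \<bar>m11 * s\<bar> + \<bar>m12 * w\<bar>" by (rule abs_triangle_ineq)
    ultimately have "\<bar>m11 * s + m12 * w\<bar> \<le> (2 * \<bar>m11\<bar> + (3 + 3 * H) * \<bar>m12\<bar>) * \<eta>"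
      by (simp add: algebra_simps)
    hence "\<bar>m11 * s + m12 * w\<bar> \<le> c / 4" using small(6) by linarith
    hence s': "\<bar>s0 + m11 * s + m12 * w\<bar> \<le> c / 2" using su0 by linarith
    have "\<bar>\<beta> * s\<bar> \<le> 1/2 * (2 * \<eta>)" unfolding abs_mult using s \<beta>(2) by (intro mult_mono) auto
    hence bs: "\<bar>\<beta> * s + E\<bar> \<le> 3 * \<eta>" using small(1) \<eta> by linarith
    have u: "(- l) ^ k * (m21 * s + m22 * w) = u0 + (d + \<kappa> * (\<beta> * s + E))"
    proof -
      have "(- l) ^ k * (m21 * s + m22 * w) = (- l) ^ k * (m22 * d) + (- l) ^ k * (m21 + m22 * \<kappa>) * s"
        by (simp add: w_def algebra_simps)
      thus ?thesis unfolding \<kappa> d by (simp add: algebra_simps)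
    qed
    have "\<bar>l ^ k * (m21 * s + m22 * w)\<bar> = \<bar>(- l) ^ k * (m21 * s + m22 * w)\<bar>" by (simp add: abs_mult power_abs)
    also have "\<dots> \<le> c / 2" unfolding u using \<kappa>s[OF bs] su0 small(5) by linarith
    finally have u': "\<bar>l ^ k * (m21 * s + m22 * w)\<bar> \<le> c / 2" .
    have "(- m) ^ k * (s0 + m11 * s + m12 * w) = \<beta> * s + E"
      by (simp add: w_def \<beta>(1) E algebra_simps)
    thus ?thesis using n funpow_pt[OF s' u'] u by (simp add: funpow_add line_def)
  qed
  define s1 where "s1 = E / (1 - \<beta>)"
  have \<beta>1: "1/2 \<le> 1 - \<beta>" using \<beta>(2) by linarith
  have s1_fix: "\<beta> * s1 + E = s1" using \<beta>1 by (simp add: s1_def field_simps)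
  have s1: "\<bar>s1\<bar> < \<eta>"
  proof -
    have "\<bar>s1\<bar> \<le> \<bar>E\<bar> / (1/2)" unfolding s1_def abs_divide using \<beta>1 by (intro divide_left_mono) auto
    thus ?thesis using small(1) by simp
  qed
  have it: "(f ^^ ((k + n) * i)) (line 0) = line (s1 * (1 - \<beta> ^ i))" for i
  proof (induction i)
    case (Suc i)
    have "\<bar>\<beta> ^ i\<bar> \<le> 1" unfolding power_abs using \<beta>(2) by (intro power_le_one) auto
    hence "\<bar>1 - \<beta> ^ i\<bar> \<le> 2" by linarith
    hence "\<bar>s1 * (1 - \<beta> ^ i)\<bar> \<le> \<eta> * 2" unfolding abs_mult using s1 by (intro mult_mono) auto
    hence "(f ^^ (k + n)) (line (s1 * (1 - \<beta> ^ i))) = line (\<beta> * (s1 * (1 - \<beta> ^ i)) + E)"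
      by (intro step) simp
    also have "\<beta> * (s1 * (1 - \<beta> ^ i)) + E = s1 * (1 - \<beta> ^ Suc i)"
      using s1_fix by (simp add: algebra_simps)
    finally have "(f ^^ (k + n)) ((f ^^ ((k + n) * i)) (line 0)) = line (s1 * (1 - \<beta> ^ Suc i))"
      unfolding Suc .
    thus ?case unfolding mult_Suc_right funpow_add[of "k + n"] o_apply .
  qed simp
  have "line s1 \<in> F"
  proof -
    have "(\<lambda>i. line (s1 * (1 - \<beta> ^ i))) \<longlonglongrightarrow> line (s1 * (1 - 0))"
      unfolding line_def using \<beta>(2) by (intro tendsto_intros LIMSEQ_power_zero) auto
    moreover have inF: "line (s1 * (1 - \<beta> ^ i)) \<in> F" for i
    proof -
      have "\<bar>d\<bar> < (3 + 3 * H) * \<eta>" using \<kappa>s[of 0] \<eta> by simp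
      hence "\<bar>u0 + d\<bar> \<le> c" using su0 small(5) c_pos by linarith
      moreover have "1 * c \<le> l * c" using l_gt c_pos by (intro mult_right_mono) auto
      ultimately have "pt 0 (u0 + d) \<in> W" by (intro pt_in_W) linarith+
      hence "(f ^^ ((k + n) * i)) (line 0) \<in> W" using funpow_W by (simp add: line_def)
      thus ?thesis unfolding it using W_subset_F by blast
    qed
    ultimately have "line (s1 * (1 - 0)) \<in> F" by (rule closed_sequentially[OF closed_F, rotated])
    thus ?thesis by simp
  qed
  moreover have "(f ^^ (k + n)) (line s1) = line s1" using step[of s1] s1 s1_fix \<eta> by simp
  moreover have "\<bar>d + \<kappa> * s1\<bar> < (3 + 3 * H) * \<eta>" using \<kappa>s[of s1] s1 \<eta> by simp
  ultimately show ?thesis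
    using that[of "k + n" s1 "d + \<kappa> * s1"] s1 \<open>0 < k\<close> by (simp add: line_def)
qed

text \<open>For large \<open>k\<close> the invariant line exists. Its slope solves a small
  perturbation of m21 + m22 \<kappa> = 0, by the intermediate value theorem near -m21/m22, and its
  height solves a linear equation with a large leading coefficient.\<close>

lemma periodic_return:
  fixes u0 s0 m11 m12 m21 m22 \<rho> e :: real
  assumes aff: "\<And>s w. \<bar>s\<bar> < \<rho> \<Longrightarrow> \<bar>w\<bar> < \<rho> \<Longrightarrow>
      (f ^^ n) (pt s (u0 + w)) = pt (s0 + m11 * s + m12 * w) (m21 * s + m22 * w)"
    and m22: "m22 \<noteq> 0" and su0: "\<bar>s0\<bar> \<le> c / 4" "\<bar>u0\<bar> \<le> c / 4" and pos: "0 < \<rho>" "0 < e"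
  obtains P s w where "0 < P" "(f ^^ P) (pt s (u0 + w)) = pt s (u0 + w)" "pt s (u0 + w) \<in> F"
    "\<bar>s\<bar> \<le> e" "\<bar>w\<bar> \<le> e"
proof -
  define \<kappa>0 where "\<kappa>0 = - m21 / m22"
  define H where "H = \<bar>\<kappa>0\<bar> + 1"
  define Q where "Q = 3 + 3 * H + (2 * \<bar>m11\<bar> + (3 + 3 * H) * \<bar>m12\<bar>)"
  \<comment> \<open>The scale is chosen so that the conditions involving \<rho>, \<open>e\<close>
    and \<open>c / 4\<close> hold together.\<close>
  define \<eta> where "\<eta> = min \<rho> (min e (c / 4)) / Q"
  have H: "1 \<le> H" by (simp add: H_def)
  have Q: "3 + 3 * H \<le> Q" "2 * \<bar>m11\<bar> + (3 + 3 * H) * \<bar>m12\<bar> \<le> Q" "0 < Q"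
  proof -
    have "0 \<le> (3 + 3 * H) * \<bar>m12\<bar>" using H by simp
    thus "3 + 3 * H \<le> Q" "2 * \<bar>m11\<bar> + (3 + 3 * H) * \<bar>m12\<bar> \<le> Q" "0 < Q"
      unfolding Q_def using H by linarith+
  qed
  have \<eta>: "0 < \<eta>" using Q pos c_pos by (simp add: \<eta>_def)
  have Q\<eta>: "Q * \<eta> = min \<rho> (min e (c / 4))" using Q by (simp add: \<eta>_def)
  have b1: "(3 + 3 * H) * \<eta> \<le> min \<rho> (min e (c / 4))"
    using mult_right_mono[OF Q(1), of \<eta>] \<eta> by (simp add: Q\<eta>)
  have b2: "(2 * \<bar>m11\<bar> + (3 + 3 * H) * \<bar>m12\<bar>) * \<eta> \<le> min \<rho> (min e (c / 4))"
    using mult_right_mono[OF Q(2), of \<eta>] \<eta> by (simp only: Q\<eta> less_imp_le)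
  define X where "X = (\<bar>m11\<bar> + \<bar>m12\<bar> * H) * H"
  have X: "0 \<le> X" "\<bar>m11\<bar> + \<bar>m12\<bar> * H \<le> X"
    using H mult_left_mono[of 1 H "\<bar>m11\<bar> + \<bar>m12\<bar> * H"] by (auto simp: X_def)
  have small: "eventually (\<lambda>k. m ^ k * y < z) sequentially" if "0 < z" for y z
  proof -
    have "(\<lambda>k. m ^ k * y) \<longlonglongrightarrow> 0 * y" using m_pos m_less by (intro tendsto_intros LIMSEQ_power_zero) auto
    thus ?thesis using that order_tendstoD(2)[of "\<lambda>k. m ^ k * y" 0] by simp
  qed
  have large: "eventually (\<lambda>k. y < l ^ k * \<bar>m22\<bar>) sequentially" for y
  proof -
    obtain K where K: "y / \<bar>m22\<bar> < l ^ K" using real_arch_pow[of l "y / \<bar>m22\<bar>"] l_gt by auto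
    have "y < l ^ k * \<bar>m22\<bar>" if "K \<le> k" for k
    proof -
      have "l ^ K \<le> l ^ k" using that l_gt by (intro power_increasing) auto
      hence "y / \<bar>m22\<bar> < l ^ k" using K by linarith
      thus ?thesis using m22 by (simp add: pos_divide_less_eq)
    qed
    thus ?thesis by (auto simp: eventually_sequentially)
  qed
  define Y where "Y = \<bar>u0\<bar> + H * \<bar>s0\<bar>"
  have "eventually (\<lambda>k. 0 < k \<and> m ^ k * X < \<bar>m22\<bar> \<and> m ^ k * X < 1/2 \<and>
      m ^ k * (2 * (\<bar>s0\<bar> + \<bar>m12\<bar> * \<eta>)) < \<eta> \<and> 1 + H * \<bar>m12\<bar> + Y / \<eta> < l ^ k * \<bar>m22\<bar>) sequentially"
    using m22 \<eta> by (intro eventually_conj small large eventually_gt_at_top) auto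
  then obtain k where k: "0 < k" "m ^ k * X < \<bar>m22\<bar>" "m ^ k * X < 1/2"
      "m ^ k * (2 * (\<bar>s0\<bar> + \<bar>m12\<bar> * \<eta>)) < \<eta>" "1 + H * \<bar>m12\<bar> + Y / \<eta> < l ^ k * \<bar>m22\<bar>"
    by (auto simp: eventually_sequentially)
  \<comment> \<open>Dividing the slope equation by (-l)^k leaves this factor in front of the term
    that is quadratic in \<kappa>.\<close>
  define \<epsilon> where "\<epsilon> = (m / l) ^ k"
  have \<epsilon>: "0 \<le> \<epsilon>" "\<epsilon> \<le> m ^ k"
  proof -
    have "m / l \<le> m / 1" using m_pos l_gt by (intro divide_left_mono) auto
    thus "\<epsilon> \<le> m ^ k" unfolding \<epsilon>_def using m_pos l_pos by (intro power_mono) auto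
  qed (use m_pos l_pos in \<open>auto simp: \<epsilon>_def\<close>)
  obtain \<kappa> where \<kappa>: "\<bar>\<kappa>\<bar> \<le> H" "\<epsilon> * ((m11 + m12 * \<kappa>) * \<kappa>) = m21 + m22 * \<kappa>"
  proof -
    define g where "g = (\<lambda>\<kappa>. \<kappa> - \<kappa>0 - \<epsilon> / m22 * ((m11 + m12 * \<kappa>) * \<kappa>))"
    have err: "\<bar>\<epsilon> / m22 * ((m11 + m12 * \<kappa>) * \<kappa>)\<bar> \<le> 1" if "\<bar>\<kappa>\<bar> \<le> H" for \<kappa>
    proof -
      have "\<bar>m11 + m12 * \<kappa>\<bar> \<le> \<bar>m11\<bar> + \<bar>m12\<bar> * H"
        using mult_left_mono[OF that, of "\<bar>m12\<bar>"] abs_triangle_ineq[of m11 "m12 * \<kappa>"] by (simp add: abs_mult)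
      hence "\<bar>(m11 + m12 * \<kappa>) * \<kappa>\<bar> \<le> X" unfolding abs_mult X_def using that H by (intro mult_mono) auto
      hence "\<epsilon> * \<bar>(m11 + m12 * \<kappa>) * \<kappa>\<bar> \<le> m ^ k * X" using \<epsilon> m_pos by (intro mult_mono) auto
      hence "\<epsilon> * \<bar>(m11 + m12 * \<kappa>) * \<kappa>\<bar> \<le> \<bar>m22\<bar>" using k(2) by linarith
      moreover have "\<bar>\<epsilon> / m22 * ((m11 + m12 * \<kappa>) * \<kappa>)\<bar> = \<epsilon> * \<bar>(m11 + m12 * \<kappa>) * \<kappa>\<bar> / \<bar>m22\<bar>"
        using \<epsilon> by (simp add: abs_mult)
      ultimately show ?thesis using m22 by (simp add: pos_divide_le_eq)
    qed
    have "\<exists>x\<ge>\<kappa>0 - 1. x \<le> \<kappa>0 + 1 \<and> g x = 0"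
    proof (rule IVT')
      show "g (\<kappa>0 - 1) \<le> 0" using err[of "\<kappa>0 - 1"] unfolding g_def H_def by linarith
      show "0 \<le> g (\<kappa>0 + 1)" using err[of "\<kappa>0 + 1"] unfolding g_def H_def by linarith
      show "continuous_on {\<kappa>0 - 1..\<kappa>0 + 1} g" unfolding g_def by (intro continuous_intros)
    qed simp
    then obtain x where "\<kappa>0 - 1 \<le> x" "x \<le> \<kappa>0 + 1" and gx: "g x = 0" by blast
    hence x: "\<bar>x - \<kappa>0\<bar> \<le> 1" by linarith
    have "m22 * g x = m22 * x + m21 - \<epsilon> * ((m11 + m12 * x) * x)"
      using m22 by (simp add: g_def \<kappa>0_def right_diff_distrib distrib_left)
    hence "\<epsilon> * ((m11 + m12 * x) * x) = m21 + m22 * x" using gx by simp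
    moreover have "\<bar>x\<bar> \<le> H" using x unfolding H_def by linarith
    ultimately show ?thesis using that by blast
  qed
  define \<beta> where "\<beta> = (- m) ^ k * (m11 + m12 * \<kappa>)"
  \<comment> \<open>The coefficient of \<open>d\<close> once \<open>E\<close> is substituted into
    the height equation; for large \<open>k\<close> its first term dominates.\<close>
  define D where "D = (- l) ^ k * m22 - 1 - \<kappa> * (- m) ^ k * m12"
  define d where "d = (u0 + \<kappa> * (- m) ^ k * s0) / D"
  define E where "E = (- m) ^ k * (s0 + m12 * d)"
  have mk: "\<bar>(- m) ^ k\<bar> = m ^ k" "m ^ k \<le> 1" "\<bar>m ^ k\<bar> = m ^ k" using m_pos m_less
    by (auto simp: power_abs intro!: power_le_one)
  have \<beta>_bound: "\<bar>\<beta>\<bar> \<le> 1/2"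
  proof -
    have "\<bar>m11 + m12 * \<kappa>\<bar> \<le> \<bar>m11\<bar> + \<bar>m12\<bar> * H"
      using mult_left_mono[OF \<kappa>(1), of "\<bar>m12\<bar>"] abs_triangle_ineq[of m11 "m12 * \<kappa>"] by (simp add: abs_mult)
    hence "m ^ k * \<bar>m11 + m12 * \<kappa>\<bar> \<le> m ^ k * X" using X m_pos by (intro mult_left_mono) auto
    thus ?thesis using k(3) by (simp add: \<beta>_def abs_mult mk)
  qed
  have \<kappa>_eq: "(- l) ^ k * (m21 + m22 * \<kappa>) = \<beta> * \<kappa>"
  proof -
    have "(- l) ^ k * \<epsilon> = (- m) ^ k" using l_pos by (simp add: \<epsilon>_def flip: power_mult_distrib)
    thus ?thesis unfolding \<kappa>(2)[symmetric] \<beta>_def by (simp add: mult.assoc[symmetric])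
  qed
  have D: "Y / \<eta> < \<bar>D\<bar>"
  proof -
    have "\<bar>\<kappa> * (- m) ^ k * m12\<bar> = m ^ k * (\<bar>\<kappa>\<bar> * \<bar>m12\<bar>)" by (simp add: abs_mult mk)
    also have "\<dots> \<le> 1 * (H * \<bar>m12\<bar>)" using \<kappa>(1) mk(2) H by (intro mult_mono) auto
    finally have "\<bar>\<kappa> * (- m) ^ k * m12\<bar> \<le> H * \<bar>m12\<bar>" by simp
    moreover have "\<bar>(- l) ^ k * m22\<bar> = l ^ k * \<bar>m22\<bar>" using l_pos by (simp add: abs_mult power_abs)
    ultimately show ?thesis using k(5) unfolding D_def by linarith
  qed
  have d_bound: "\<bar>d\<bar> < \<eta>"
  proof -
    have "\<bar>\<kappa> * (- m) ^ k * s0\<bar> = m ^ k * (\<bar>\<kappa>\<bar> * \<bar>s0\<bar>)" by (simp add: abs_mult mk)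
    also have "\<dots> \<le> 1 * (H * \<bar>s0\<bar>)" using \<kappa>(1) mk(2) H by (intro mult_mono) auto
    finally have "\<bar>u0 + \<kappa> * (- m) ^ k * s0\<bar> \<le> Y" unfolding Y_def by linarith
    moreover have "Y < \<eta> * \<bar>D\<bar>" using D \<eta> by (simp add: pos_divide_less_eq mult.commute)
    moreover have "0 \<le> Y" using H by (simp add: Y_def)
    ultimately have "\<bar>u0 + \<kappa> * (- m) ^ k * s0\<bar> < \<eta> * \<bar>D\<bar>" "D \<noteq> 0" by auto
    thus ?thesis by (simp add: d_def pos_divide_less_eq)
  qed
  have d_eq: "(- l) ^ k * (m22 * d) = u0 + d + \<kappa> * E"
  proof -
    have "0 \<le> Y" using H by (simp add: Y_def)
    hence "0 \<le> Y / \<eta>" using \<eta> by simp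
    hence "D \<noteq> 0" using D by auto
    hence "D * d = u0 + \<kappa> * (- m) ^ k * s0" by (simp add: d_def)
    thus ?thesis by (simp add: D_def E_def algebra_simps)
  qed
  have E_bound: "2 * \<bar>E\<bar> < \<eta>"
  proof -
    have "\<bar>m12 * d\<bar> \<le> \<bar>m12\<bar> * \<eta>" using d_bound by (simp add: abs_mult mult_left_mono)
    hence "\<bar>s0 + m12 * d\<bar> \<le> \<bar>s0\<bar> + \<bar>m12\<bar> * \<eta>" by linarith
    hence "m ^ k * (2 * \<bar>s0 + m12 * d\<bar>) \<le> m ^ k * (2 * (\<bar>s0\<bar> + \<bar>m12\<bar> * \<eta>))"
      using m_pos by (intro mult_left_mono) auto
    moreover have "2 * \<bar>E\<bar> = m ^ k * (2 * \<bar>s0 + m12 * d\<bar>)" by (simp add: E_def abs_mult mk)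
    ultimately show ?thesis using k(4) by linarith
  qed
  have b: "(3 + 3 * H) * \<eta> \<le> \<rho>" "(3 + 3 * H) * \<eta> \<le> c / 4"
    "(2 * \<bar>m11\<bar> + (3 + 3 * H) * \<bar>m12\<bar>) * \<eta> \<le> c / 4" using b1 b2 by auto
  obtain P s w where Psw: "0 < P" "(f ^^ P) (pt s (u0 + w)) = pt s (u0 + w)" "pt s (u0 + w) \<in> F"
    "\<bar>s\<bar> \<le> \<eta>" "\<bar>w\<bar> \<le> (3 + 3 * H) * \<eta>"
    using periodic_of_stable_line[OF aff \<beta>_def \<beta>_bound \<kappa>_eq E_def d_eq E_bound d_bound \<kappa>(1) b su0 k(1)]
    by metis
  have "1 * \<eta> \<le> (3 + 3 * H) * \<eta>" using H \<eta> by (intro mult_right_mono) auto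
  thus ?thesis using that[OF Psw(1-3)] Psw(4,5) b1 by auto
qed

text \<open>A short piece of \<open>W\<close> with an image in the given open set contains a
  homoclinic point. A periodic point of \<open>F\<close> close to it is carried by
  \<open>f ^^ j\<close> into the open set, and the image is again periodic.\<close>

lemma periodic_dense: "F \<subseteq> closure {x \<in> F. \<exists>n>0. (f ^^ n) x = x}"
proof
  fix x assume x: "x \<in> F"
  show "x \<in> closure {x \<in> F. \<exists>n>0. (f ^^ n) x = x}"
  proof (rule closure_iff_nhds_not_empty[THEN iffD2], intro allI impI)
    fix A V assume V: "V \<subseteq> A" "open V" "x \<in> V"
    have VF: "V \<inter> F \<noteq> {}" using V(3) x by blast
    obtain j u1 d where seg: "W_segment (pt 0 u1) (d *\<^sub>R eu)"
      "\<And>t. t \<in> {0<..<1} \<Longrightarrow> (f ^^ j) (pt 0 u1 + t *\<^sub>R (d *\<^sub>R eu)) \<in> V"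
      "\<And>t. t \<in> {0<..<1} \<Longrightarrow> \<bar>u1 + t * d\<bar> \<le> c / 4"
      using W_segment_in_open[OF V(2) VF] by metis
    obtain t n0 where t: "t \<in> {0<..<1}" "homoclinic_at n0 (pt 0 u1 + t *\<^sub>R (d *\<^sub>R eu))"
      using W_segment_homoclinic[OF seg(1)] by blast
    define u0 where "u0 = u1 + t * d"
    have q: "pt 0 u1 + t *\<^sub>R (d *\<^sub>R eu) = pt 0 u0"
      by (simp add: u0_def pt_add linear_cmul[OF linear_S_lin] linear_cmul[OF linear_U_lin])
    have c4: "0 < c / 4" using c_pos by simp
    obtain n s0 where n: "\<forall>j<n. fst ((f ^^ j) (pt 0 u0)) \<noteq> 0" "(f ^^ n) (pt 0 u0) = pt s0 0" "\<bar>s0\<bar> < c / 4"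
      using homoclinic_near[OF t(2)[unfolded q] c4] by metis
    obtain M r where M: "linear M" "0 < r" "\<And>h. norm h < r \<Longrightarrow> (f ^^ n) (pt 0 u0 + h) = (f ^^ n) (pt 0 u0) + M h"
      "\<And>v. v \<in> unstable_cone \<Longrightarrow> M v \<in> unstable_cone"
      "\<And>v. v \<in> unstable_cone \<Longrightarrow> \<bar>fst v\<bar> \<le> \<bar>fst (M v)\<bar>"
      using locally_affine[OF n(1)] by metis
    \<comment> \<open>With both coordinates below \<rho>, the displacement has norm below
      \<open>r\<close>, the radius of the affine neighbourhood.\<close>
    define \<rho> where "\<rho> = r / (norm es + norm eu)"
    have pos: "0 < norm es + norm eu" by (intro add_pos_nonneg) (auto simp: es_def zero_prod_def)
    have \<rho>: "0 < \<rho>" using M(2) pos by (simp add: \<rho>_def)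
    have aff: "(f ^^ n) (pt s (u0 + w)) = pt (s0 + S_lin (M es) * s + S_lin (M eu) * w) (U_lin (M es) * s + U_lin (M eu) * w)"
      if "\<bar>s\<bar> < \<rho>" "\<bar>w\<bar> < \<rho>" for s w
    proof -
      define h where "h = s *\<^sub>R es + w *\<^sub>R eu"
      have "norm h \<le> \<bar>s\<bar> * norm es + \<bar>w\<bar> * norm eu" unfolding h_def using norm_triangle_ineq[of "s *\<^sub>R es" "w *\<^sub>R eu"] by simp
      also have "\<dots> < \<rho> * (norm es + norm eu)"
      proof -
        have "\<bar>s\<bar> * norm es < \<rho> * norm es" using that by (intro mult_strict_right_mono) (auto simp: es_def zero_prod_def)
        moreover have "\<bar>w\<bar> * norm eu \<le> \<rho> * norm eu" using that by (intro mult_right_mono) auto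
        ultimately show ?thesis by (simp add: distrib_left)
      qed
      also have "\<dots> = r" using pos by (simp add: \<rho>_def)
      finally have h: "norm h < r" .
      have 1: "pt 0 u0 + h = pt s (u0 + w)"
        by (simp add: pt_add h_def linear_add[OF linear_S_lin] linear_add[OF linear_U_lin]
            linear_cmul[OF linear_S_lin] linear_cmul[OF linear_U_lin])
      have 2: "M h = s *\<^sub>R M es + w *\<^sub>R M eu"
        by (simp add: h_def linear_add[OF M(1)] linear_cmul[OF M(1)])
      have "(f ^^ n) (pt s (u0 + w)) = pt s0 0 + (s *\<^sub>R M es + w *\<^sub>R M eu)"
        using M(3)[OF h] unfolding 1 2 n(2) .
      also have "\<dots> = pt (s0 + (s * S_lin (M es) + w * S_lin (M eu))) (s * U_lin (M es) + w * U_lin (M eu))"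
        by (simp add: pt_add linear_add[OF linear_S_lin] linear_add[OF linear_U_lin]
            linear_cmul[OF linear_S_lin] linear_cmul[OF linear_U_lin])
      finally show ?thesis by (simp only: mult.commute add.assoc)
    qed
    have m22: "U_lin (M eu) \<noteq> 0" using M(4,5)[OF eu_cone] by (intro U_lin_cone) (auto simp: eu_def)
    define g where "g = (\<lambda>x. (f ^^ j) (pt (fst x) (u0 + snd x)))"
    have "continuous_on UNIV g" unfolding g_def
      by (rule continuous_on_compose2[OF continuous_funpow[of UNIV j]]) (intro continuous_intros, simp)
    hence "open (g -` V)" using V(2) by (simp add: continuous_on_open_vimage)
    moreover have "(0, 0) \<in> g -` V" using seg(2)[OF t(1)] unfolding q by (simp add: g_def)
    ultimately obtain e0 where e0: "0 < e0" "ball (0, 0) e0 \<subseteq> g -` V" by (meson openE)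
    \<comment> \<open>The norm of \<open>(s, w)\<close> is at most |s| + |w| <= 2 e, which is then
      below \<open>e0\<close>.\<close>
    define e where "e = e0 / 3"
    have e: "0 < e" using e0 by (simp add: e_def)
    obtain P s w where Psw: "0 < P" "(f ^^ P) (pt s (u0 + w)) = pt s (u0 + w)" "pt s (u0 + w) \<in> F"
        "\<bar>s\<bar> \<le> e" "\<bar>w\<bar> \<le> e"
    proof (rule periodic_return[OF aff m22 _ _ \<rho> e])
      show "\<bar>s0\<bar> \<le> c / 4" "\<bar>u0\<bar> \<le> c / 4" using n(3) seg(3)[OF t(1)] by (auto simp: u0_def)
    qed
    define z where "z = (f ^^ j) (pt s (u0 + w))"
    have "z \<in> V"
    proof -
      have "norm (s, w) \<le> norm s + norm w" by (rule norm_Pair_le)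
      moreover have "dist (0, 0) (s, w) = norm (s, w)"
        using dist_0_norm[of "(s, w)"] by (simp add: zero_prod_def)
      ultimately have "(s, w) \<in> ball (0, 0) e0" using Psw(4,5) e by (simp add: e_def)
      thus ?thesis using e0(2) by (auto simp: g_def z_def)
    qed
    moreover have "z \<in> F" unfolding z_def using Psw(3) by (rule funpow_F)
    moreover have "(f ^^ P) z = z"
    proof -
      have "(f ^^ P) z = (f ^^ (P + j)) (pt s (u0 + w))" by (simp add: z_def funpow_add)
      also have "\<dots> = (f ^^ j) ((f ^^ P) (pt s (u0 + w)))" by (simp add: add.commute[of P] funpow_add)
      finally show ?thesis by (simp add: Psw(2) z_def)
    qed
    ultimately have "z \<in> {x \<in> F. \<exists>n>0. (f ^^ n) x = x} \<inter> A" using V(1) Psw(1) by blast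
    thus "{x \<in> F. \<exists>n>0. (f ^^ n) x = x} \<inter> A \<noteq> {}" by blast
  qed
qed

subsection \<open>The realm of attraction\<close>

lemma continuous_finv: "continuous_on S finv"
proof -
  have "finv = (\<lambda>p. (- snd p / (l * m), fst p - 1 + (l + m) * \<bar>snd p / (l * m)\<bar>))"
    by (auto simp: finv_def fun_eq_iff)
  thus ?thesis using lm_pos by (auto intro!: continuous_intros)
qed

lemma f_image_eq: "f ` A = finv -` A"
proof
  show "f ` A \<subseteq> finv -` A" by (auto simp: finv_f simp del: split_paired_All)
  show "finv -` A \<subseteq> f ` A"
  proof
    fix p assume "p \<in> finv -` A"
    hence "f (finv p) \<in> f ` A" by blast
    thus "p \<in> f ` A" by (simp only: f_finv)
  qed
qed

text \<open>Cavalieri: the horizontal slice of the image at height \<open>y\<close> is a translate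
  of the vertical slice of \<open>A\<close> at x = - y / (l m). Integrating over \<open>y\<close>
  gives the factor l m.\<close>

lemma emeasure_f_image:
  assumes "open A"
  shows "emeasure lborel (f ` A) = ennreal (l * m) * emeasure lborel A"
proof -
  have fA: "open (f ` A)"
    unfolding f_image_eq using continuous_finv[of UNIV] assms by (simp add: continuous_on_open_vimage)
  define g where "g = (\<lambda>x. emeasure lborel (Pair x -` A))"
  have sets_A: "A \<in> sets (lborel \<Otimes>\<^sub>M lborel)" "f ` A \<in> sets (lborel \<Otimes>\<^sub>M lborel)"
    using assms fA by (simp_all only: lborel_prod sets_lborel borel_open)
  have g: "g \<in> borel_measurable borel"
    using lborel.measurable_emeasure_Pair[OF sets_A(1)] by (simp add: g_def)
  have slice: "emeasure lborel ((\<lambda>x. (x, y)) -` (f ` A)) = g (0 + (- 1 / (l * m)) * y)" for y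
  proof -
    have "(\<lambda>x. (x, y)) -` (f ` A) = (+) ((l + m) * \<bar>y / (l * m)\<bar> - 1) -` (Pair (- y / (l * m)) -` A)"
      by (auto simp: f_image_eq finv_def algebra_simps)
    moreover have "Pair (- y / (l * m)) -` A \<in> sets borel"
    proof -
      have "open (Pair (- y / (l * m)) -` A)"
        using assms by (intro open_vimage continuous_intros)
      thus ?thesis by simp
    qed
    ultimately show ?thesis by (simp add: emeasure_lborel_vimage_plus g_def)
  qed
  have "emeasure lborel (f ` A) = (\<integral>\<^sup>+y. g (0 + (- 1 / (l * m)) * y) \<partial>lborel)"
    using lborel_pair.emeasure_pair_measure_alt2[OF sets_A(2)] by (simp only: lborel_prod slice)
  moreover have "(\<integral>\<^sup>+x. g x \<partial>lborel) = ennreal \<bar>- 1 / (l * m)\<bar> * (\<integral>\<^sup>+y. g (0 + (- 1 / (l * m)) * y) \<partial>lborel)"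
    using g lm_pos by (intro nn_integral_real_affine) auto
  moreover have "emeasure lborel A = (\<integral>\<^sup>+x. g x \<partial>lborel)"
    using lborel.emeasure_pair_measure_alt[OF sets_A(1)] by (simp only: lborel_prod g_def)
  ultimately have "emeasure lborel A = ennreal \<bar>- 1 / (l * m)\<bar> * emeasure lborel (f ` A)" by simp
  moreover have "ennreal (l * m) * ennreal \<bar>- 1 / (l * m)\<bar> = 1"
    using l_pos m_pos by (simp flip: ennreal_mult)
  ultimately show ?thesis by (simp only: mult.assoc[symmetric] mult_1)
qed

lemma open_funpow_image:
  assumes "open A" shows "open ((f ^^ n) ` A)"
proof (induction n)
  case (Suc n)
  have "(f ^^ Suc n) ` A = finv -` ((f ^^ n) ` A)"
    by (simp only: funpow.simps image_comp[symmetric] f_image_eq)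
  thus ?case using Suc continuous_finv[of UNIV] by (simp add: continuous_on_open_vimage)
qed (simp add: assms)

lemma emeasure_funpow_image:
  assumes "open A"
  shows "emeasure lborel ((f ^^ n) ` A) = ennreal ((l * m) ^ n) * emeasure lborel A"
proof (induction n)
  case (Suc n)
  have "emeasure lborel ((f ^^ Suc n) ` A) = ennreal (l * m) * emeasure lborel ((f ^^ n) ` A)"
    using emeasure_f_image[OF open_funpow_image[OF assms]] by (simp only: funpow.simps image_comp[symmetric])
  moreover have "ennreal ((l * m) ^ Suc n) = ennreal (l * m) * ennreal ((l * m) ^ n)"
    using lm_pos by (simp only: power_Suc ennreal_mult less_imp_le zero_le_power)
  ultimately show ?case using Suc by (simp only: mult.assoc)
qed simp

lemma F_nonempty: "F \<noteq> {}" using pt_fixed_in_F by blast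

text \<open>The area of the n-th image of \<open>D\<close> tends to 0, so a disc of radius
  \<open>e\<close> around the n-th iterate of \<open>x\<close> does not fit into it and meets its
  boundary. Boundary points come from the boundary of \<open>D\<close>: they lie in \<open>W\<close>
  or on images of a stable segment that shrink to the saddle.\<close>

lemma attracted_region:
  assumes D: "open D" "bounded D" and x: "x \<in> D"
    and bd: "closure D - D \<subseteq> W \<union> {pt s 0 | s. 0 \<le> s \<and> s \<le> c}"
  shows "(\<lambda>n. infdist ((f ^^ n) x) F) \<longlonglongrightarrow> 0"
proof (rule LIMSEQ_I)
  fix \<delta> :: real assume "0 < \<delta>"
  define e where "e = \<delta> / 2"
  have e: "0 < e" using \<open>0 < \<delta>\<close> by (simp add: e_def)
  have cD: "compact (closure D)" using D(2) by (simp add: compact_closure)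
  obtain a :: real where a: "emeasure lborel D = ennreal a" "0 \<le> a"
    using emeasure_bounded_finite[OF D(2)] by (cases "emeasure lborel D") auto
  \<comment> \<open>The area of a disc of radius \<open>e\<close>.\<close>
  define v where "v = unit_ball_vol 2 * e\<^sup>2"
  have v: "0 < v" using e by (simp add: v_def)
  have "(\<lambda>n. (l * m) ^ n * a) \<longlonglongrightarrow> 0 * a"
    using lm_pos lm_less_1 by (intro tendsto_intros LIMSEQ_power_zero) auto
  hence ev1: "eventually (\<lambda>n. (l * m) ^ n * a < v) sequentially"
    using v order_tendstoD(2)[of _ 0] by auto
  have "(\<lambda>n. m ^ n * (c * norm es)) \<longlonglongrightarrow> 0 * (c * norm es)"
    using m_pos m_less by (intro tendsto_intros LIMSEQ_power_zero) auto
  hence ev2: "eventually (\<lambda>n. m ^ n * (c * norm es) < e) sequentially"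
    using e order_tendstoD(2)[of _ 0] by auto
  have "eventually (\<lambda>n. infdist ((f ^^ n) x) F < \<delta>) sequentially"
    using ev1 ev2
  proof eventually_elim
    case (elim n)
    define p where "p = (f ^^ n) x"
    define G where "G = (f ^^ n) ` D"
    have G: "open G" "p \<in> G" using open_funpow_image[OF D(1)] x by (auto simp: G_def p_def)
    have "\<not> ball p e \<subseteq> G"
    proof
      assume "ball p e \<subseteq> G"
      hence "emeasure lborel (ball p e) \<le> emeasure lborel G" using G(1) by (intro emeasure_mono) auto
      also have "\<dots> = ennreal ((l * m) ^ n * a)"
        using emeasure_funpow_image[OF D(1)] lm_pos a by (simp add: G_def ennreal_mult)
      also have "\<dots> < ennreal v" using elim(1) a lm_pos by (simp add: ennreal_less_iff)
      finally show False using e by (simp add: emeasure_ball v_def power2_eq_square)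
    qed
    moreover have "p \<in> ball p e \<inter> G" using e G(2) by simp
    ultimately have "ball p e \<inter> frontier G \<noteq> {}"
      by (intro connected_Int_frontier connected_ball) blast+
    then obtain z where z: "z \<in> ball p e" "z \<in> closure G" "z \<notin> G"
      using G(1) by (auto simp: frontier_def interior_open)
    have "closed ((f ^^ n) ` closure D)"
      using cD compact_continuous_image continuous_funpow compact_imp_closed by blast
    hence "closure G \<subseteq> (f ^^ n) ` closure D"
      unfolding G_def by (intro closure_minimal image_mono closure_subset)
    then obtain d where d: "d \<in> closure D" "z = (f ^^ n) d" using z(2) by blast
    hence "d \<notin> D" using z(3) by (auto simp: G_def)
    hence "d \<in> W \<union> {pt s 0 | s. 0 \<le> s \<and> s \<le> c}" using bd d by blast
    moreover have "infdist p F \<le> dist p z + infdist z F" using infdist_triangle[of p F z] by linarith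
    moreover have "dist p z < e" using z(1) by simp
    moreover have "infdist z F \<le> e"
      if bd: "d \<in> W \<union> {pt s 0 | s. 0 \<le> s \<and> s \<le> c}"
    proof (cases "d \<in> W")
      case True
      hence "z \<in> F" using d funpow_W W_subset_F by blast
      thus ?thesis using e by simp
    next
      case False
      then obtain s where s: "d = pt s 0" "0 \<le> s" "s \<le> c" using bd by blast
      have "m * s \<le> 1 * c" using s m_pos m_less by (intro mult_mono) auto
      hence z': "z = pt 0 0 + ((- m) ^ n * s) *\<^sub>R es" using d s funpow_pt_stable[of s n] c_pos
        by (simp add: pt_add linear_cmul[OF linear_S_lin] linear_cmul[OF linear_U_lin])
      have "infdist z F \<le> dist z (pt 0 0)" by (intro infdist_le pt_fixed_in_F)
      also have "\<dots> = m ^ n * (s * norm es)" using s m_pos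
        by (simp add: z' dist_norm abs_mult power_abs)
      also have "\<dots> \<le> m ^ n * (c * norm es)" using s m_pos by (intro mult_left_mono mult_right_mono) auto
      finally show ?thesis using elim(2) by linarith
    qed
    ultimately show ?case unfolding p_def e_def by linarith
  qed
  then obtain N where "\<And>n. N \<le> n \<Longrightarrow> infdist ((f ^^ n) x) F < \<delta>" by (auto simp: eventually_sequentially)
  thus "\<exists>no. \<forall>n\<ge>no. norm (infdist ((f ^^ n) x) F - 0) < \<delta>" by (auto simp: infdist_nonneg)
qed

lemma attracted_imp_realm:
  assumes "(\<lambda>n. infdist ((f ^^ n) x) F) \<longlonglongrightarrow> 0"
  shows "x \<in> realm f F"
proof -
  have "eventually (\<lambda>n. infdist ((f ^^ n) x) F < 1) sequentially"
    using order_tendstoD(2)[OF assms, of 1] by simp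
  then obtain N where N: "\<And>n. N \<le> n \<Longrightarrow> infdist ((f ^^ n) x) F < 1" by (auto simp: eventually_sequentially)
  have "\<exists>k\<ge>n. (f ^^ k) x \<in> {y. infdist y F \<le> 1}" for n
    using N[of "max N n"] by (intro exI[of _ "max N n"]) auto
  moreover have "compact {y. infdist y F \<le> 1}"
    using compact_infdist_le[OF F_nonempty compact_F] by simp
  ultimately have "omega_limit f x \<noteq> {}" using omega_limit_meets_compact by blast
  moreover have "y \<in> F" if y: "y \<in> omega_limit f x" for y
  proof -
    obtain r where r: "strict_mono r" "(\<lambda>n. (f ^^ r n) x) \<longlonglongrightarrow> y"
      using y unfolding omega_limit_def by blast
    have "(\<lambda>n. infdist ((f ^^ r n) x) F) \<longlonglongrightarrow> 0"
      using LIMSEQ_subseq_LIMSEQ[OF assms r(1)] by (simp add: o_def)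
    hence "infdist y F = 0" using LIMSEQ_unique tendsto_infdist[OF r(2)] by blast
    thus ?thesis using in_closed_iff_infdist_zero[OF closed_F F_nonempty] by blast
  qed
  ultimately show ?thesis unfolding realm_def by blast
qed

section \<open>The homoclinic triangle and the measure of the realm\<close>

definition s_hom :: real where "s_hom = 2 * (l + m) * m * c / (l + 3 * m)"

lemma s_hom: "0 < s_hom" "s_hom \<le> c"
proof -
  show "0 < s_hom" using l_pos m_pos c_pos by (simp add: s_hom_def)
  have "(l + m) * (2 * m) \<le> (l + m) * 1" using m_less l_pos m_pos by (intro mult_left_mono) auto
  hence "2 * (l + m) * m \<le> l + 3 * m" using m_pos by (simp add: algebra_simps)
  hence "2 * (l + m) * m * c \<le> (l + 3 * m) * c" using c_pos by (intro mult_right_mono) auto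
  thus "s_hom \<le> c" using l_pos m_pos by (simp add: s_hom_def pos_divide_le_eq mult.commute)
qed

text \<open>The segment from the turning point \<open>pt 0 (l * c)\<close> of the unstable manifold to its first
  intersection \<open>pt s_hom 0\<close> with the stable line.\<close>

lemma homoclinic_edge_in_W:
  assumes "0 \<le> \<theta>" "\<theta> \<le> 1"
  shows "pt (\<theta> * s_hom) (l * c * (1 - \<theta>)) \<in> W"
proof -
  define k where "k = \<theta> * c / (l + 3 * m)"
  have k_eq: "k * (l + 3 * m) = \<theta> * c" using l_pos m_pos by (simp add: k_def)
  have k: "0 \<le> k" using assms c_pos l_pos m_pos by (simp add: k_def)
  \<comment> \<open>Found by going backwards: \<open>pt 0 (- (c + \<tau>))\<close> has x-coordinate
    -\<tau>, and the left-hand branch maps it to the required point of the edge.\<close>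
  define \<tau> where "\<tau> = k * (l - m)"
  have \<tau>: "0 \<le> \<tau>" "\<tau> \<le> c"
  proof -
    show "0 \<le> \<tau>" using k m_less_l by (simp add: \<tau>_def)
    have "k * (l - m) \<le> k * (l + 3 * m)" using k m_pos by (intro mult_left_mono) auto
    also have "\<dots> \<le> 1 * c" unfolding k_eq using assms c_pos by (intro mult_right_mono) auto
    finally show "\<tau> \<le> c" by (simp add: \<tau>_def)
  qed
  \<comment> \<open>As \<tau> <= c and l^2 > 2, the preimage \<open>(c + \<tau>) / l\<close> does
    not pass the turning point, so \<open>pt_in_W\<close> covers it.\<close>
  have "2 * c \<le> l\<^sup>2 * c" using l_sq c_pos by (intro mult_right_mono) auto
  hence "(c + \<tau>) / l \<le> l * c" using \<tau> l_pos by (simp add: pos_divide_le_eq power2_eq_square mult_ac)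
  moreover have "0 \<le> (c + \<tau>) / l" using \<tau> c_pos l_pos by simp
  ultimately have "pt 0 ((c + \<tau>) / l) \<in> W" using c_pos by (intro pt_in_W) linarith+
  moreover have "f (pt 0 ((c + \<tau>) / l)) = pt 0 (- (c + \<tau>))"
    using \<open>0 \<le> (c + \<tau>) / l\<close> c_pos l_pos by (subst f_pt_unstable) auto
  ultimately have "pt 0 (- (c + \<tau>)) \<in> W" using f_W_subset by metis
  hence "f (pt 0 (- (c + \<tau>))) \<in> W" by (rule f_W_subset)
  moreover have "f (pt 0 (- (c + \<tau>))) = pt (2 * (l + m) * m * k) (l * c - l * (k * (l + 3 * m)))"
  proof -
    have "f (pt 0 (- (c + \<tau>))) = ((c + l * c + m * c + l * m * c) - m * (c + \<tau>) - l * m * c - (l + m) * \<tau>, l * m * \<tau>)"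
      using \<tau>(1) unfolding c_eq' by (simp add: pt_def f_eq algebra_simps)
    thus ?thesis unfolding \<tau>_def by (simp add: pt_def algebra_simps)
  qed
  moreover have "2 * (l + m) * m * k = \<theta> * s_hom" by (simp add: k_def s_hom_def)
  moreover have "l * c - l * (k * (l + 3 * m)) = l * c * (1 - \<theta>)" unfolding k_eq by (simp add: algebra_simps)
  ultimately show ?thesis by simp
qed

text \<open>The open triangle with vertices \<open>pt 0 0\<close>, \<open>pt 0 (l * c)\<close> and
  \<open>pt s_hom 0\<close>.\<close>

definition hom_triangle :: "(real \<times> real) set" where
  "hom_triangle = {p. 0 < s_coord p \<and> 0 < u_coord p \<and> s_coord p / s_hom + u_coord p / (l * c) < 1}"

lemma hom_triangle_region: "open hom_triangle" "bounded hom_triangle" "hom_triangle \<noteq> {}" "closure hom_triangle - hom_triangle \<subseteq> W \<union> {pt s 0 | s. 0 \<le> s \<and> s \<le> c}"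
proof -
  have lc: "0 < l * c" using l_pos c_pos by simp
  note cont = continuous_coords
  have "open ({p. 0 < s_coord p} \<inter> {p. 0 < u_coord p} \<inter> {p. s_coord p / s_hom + u_coord p / (l * c) < 1})"
    using s_hom(1) lc by (intro open_Int open_Collect_less continuous_intros cont) auto
  moreover have "hom_triangle = {p. 0 < s_coord p} \<inter> {p. 0 < u_coord p} \<inter> {p. s_coord p / s_hom + u_coord p / (l * c) < 1}"
    by (auto simp: hom_triangle_def)
  ultimately show "open hom_triangle" by simp
  define E where "E = {p. 0 \<le> s_coord p} \<inter> {p. 0 \<le> u_coord p} \<inter> {p. s_coord p / s_hom + u_coord p / (l * c) \<le> 1}"
  have "closed E" unfolding E_def
    using s_hom(1) lc by (intro closed_Int closed_Collect_le continuous_intros cont) auto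
  moreover have DE: "hom_triangle \<subseteq> E" by (auto simp: hom_triangle_def E_def)
  ultimately have cE: "closure hom_triangle \<subseteq> E" by (rule closure_minimal[rotated])
  have E_ratio: "0 \<le> s_coord p / s_hom" "0 \<le> u_coord p / (l * c)" if "p \<in> E" for p
    using that s_hom(1) lc by (auto simp: E_def)
  have "hom_triangle \<subseteq> (\<lambda>q. pt (fst q) (snd q)) ` ({0..s_hom} \<times> {0..l * c})"
  proof
    fix p assume "p \<in> hom_triangle"
    hence p: "p \<in> E" using DE by blast
    hence "s_coord p / s_hom \<le> 1" "u_coord p / (l * c) \<le> 1" "0 \<le> s_coord p" "0 \<le> u_coord p"
      using E_ratio[OF p] unfolding E_def by auto
    hence "(s_coord p, u_coord p) \<in> {0..s_hom} \<times> {0..l * c}" using s_hom(1) lc by (simp add: pos_divide_le_eq)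
    moreover have "p = pt (fst (s_coord p, u_coord p)) (snd (s_coord p, u_coord p))" by (simp add: pt_coords)
    ultimately show "p \<in> (\<lambda>q. pt (fst q) (snd q)) ` ({0..s_hom} \<times> {0..l * c})" by blast
  qed
  moreover have "compact ((\<lambda>q. pt (fst q) (snd q)) ` ({0..s_hom} \<times> {0..l * c}))"
    by (intro compact_continuous_image compact_Times compact_Icc continuous_intros)
  ultimately show "bounded hom_triangle" using bounded_subset compact_imp_bounded by blast
  have "pt (s_hom / 3) (l * c / 3) \<in> hom_triangle" using s_hom(1) lc c_pos l_pos by (simp add: hom_triangle_def)
  thus "hom_triangle \<noteq> {}" by blast
  show "closure hom_triangle - hom_triangle \<subseteq> W \<union> {pt s 0 | s. 0 \<le> s \<and> s \<le> c}"
  proof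
    fix p assume p: "p \<in> closure hom_triangle - hom_triangle"
    define s u where "s = s_coord p" and "u = u_coord p"
    have p_eq: "p = pt s u" by (simp add: s_def u_def pt_coords)
    have pE: "p \<in> E" using p cE by blast
    hence h: "0 \<le> s" "0 \<le> u" "s / s_hom + u / (l * c) \<le> 1" by (auto simp: E_def s_def u_def)
    have r: "0 \<le> s / s_hom" "0 \<le> u / (l * c)" using E_ratio[OF pE] by (auto simp: s_def u_def)
    have "\<not> (0 < s \<and> 0 < u \<and> s / s_hom + u / (l * c) < 1)" using p by (simp add: hom_triangle_def s_def u_def)
    \<comment> \<open>The three sides: the unstable segment, the stable segment, and the edge from
      \<open>homoclinic_edge_in_W\<close>.\<close>
    then consider "s = 0" | "u = 0" | "s / s_hom + u / (l * c) = 1" using h by linarith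
    thus "p \<in> W \<union> {pt s 0 | s. 0 \<le> s \<and> s \<le> c}"
    proof cases
      case 1
      have "u / (l * c) \<le> 1" using h r by linarith
      hence "u \<le> l * c" using lc by (simp add: pos_divide_le_eq)
      thus ?thesis using pt_in_W[of u] h(2) c_pos by (simp add: p_eq 1)
    next
      case 2
      have "s / s_hom \<le> 1" using h r by linarith
      hence "s \<le> c" using s_hom by (simp add: pos_divide_le_eq)
      thus ?thesis using h(1) by (auto simp: p_eq 2)
    next
      case 3
      define \<theta> where "\<theta> = s / s_hom"
      have \<theta>: "0 \<le> \<theta>" "\<theta> \<le> 1" using r 3 unfolding \<theta>_def by linarith+
      have "s = \<theta> * s_hom" using s_hom(1) by (simp add: \<theta>_def)
      moreover have "u / (l * c) = 1 - \<theta>" using 3 by (simp add: \<theta>_def)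
      hence "u = l * c * (1 - \<theta>)" using l_pos c_pos by (simp add: divide_eq_eq mult.commute)
      ultimately have "p \<in> W" unfolding p_eq using homoclinic_edge_in_W[OF \<theta>] by simp
      thus ?thesis by blast
    qed
  qed
qed

lemma hom_triangle_subset_realm: "hom_triangle \<subseteq> realm f F"
  using attracted_region[OF hom_triangle_region(1,2) _ hom_triangle_region(4)] attracted_imp_realm by blast

text \<open>Measurability turns measure 0 into negligibility, and a negligible realm could not
  contain a nonempty open triangle.\<close>

lemma emeasure_realm_pos: "0 < emeasure lebesgue (realm f F)"
proof -
  have "realm f F \<in> sets borel"
    using continuous_funpow by (intro realm_in_borel closed_F F_nonempty borel_measurable_continuous_onI)
  hence meas: "realm f F \<in> sets lebesgue" by simp
  have "emeasure lebesgue (realm f F) \<noteq> 0"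
  proof
    assume "emeasure lebesgue (realm f F) = 0"
    hence "negligible (realm f F)" using meas by (simp add: negligible_iff_null_sets null_sets_def)
    hence "negligible hom_triangle" using hom_triangle_subset_realm negligible_subset by blast
    thus False using open_not_negligible hom_triangle_region by blast
  qed
  thus ?thesis by (simp add: zero_less_iff_neq_zero)
qed

text \<open>For minimality, the point with limit set \<open>F\<close> lies in the realm of
  \<open>F\<close>, hence in that of \<open>F'\<close>, which forces \<open>F\<close> into
  \<open>F'\<close>.\<close>

lemma attractor_F: "attractor f F"
  unfolding attractor_def
proof (intro conjI allI impI)
  fix F' assume F': "closed F' \<and> F' \<subseteq> F \<and> realm f F' = realm f F"
  obtain x where x: "x \<in> F" "omega_limit f x = F" by (rule dense_orbit)
  hence "x \<in> realm f F" using F_nonempty by (simp add: realm_def)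
  hence "x \<in> realm f F'" using F' by simp
  thus "F' = F" using F' x(2) unfolding realm_def by blast
qed (use closed_F emeasure_realm_pos in auto)

lemma chaotic_attractor_F: "chaotic_attractor f F"
  unfolding chaotic_attractor_def
  using compact_F f_image_F attractor_F transitive_F periodic_dense by blast

section \<open>The fixed point in the lower half plane\<close>

lemma saddle_fixed_point_pt: "saddle_fixed_point f (pt 0 0)" "snd (pt 0 0) < 0"
proof -
  define A1 where "A1 = (\<lambda>h::real \<times> real. (snd h - (l + m) * fst h, - (l * m) * fst h))"
  have "((\<lambda>p. (1 + snd p - (l + m) * fst p, - (l * m) * fst p)) has_derivative A1) (at (pt 0 0))"
    unfolding A1_def by (rule derivative_eq_intros refl | simp add: fun_eq_iff)+
  moreover have "open {p::real \<times> real. 0 < fst p}" by (intro open_Collect_less continuous_intros)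
  ultimately have D: "(f has_derivative A1) (at (pt 0 0))"
    by (rule has_derivative_transform_within_open) (use c_pos in \<open>auto simp: f_eq pt_def\<close>)
  have "complex_eigenvalue A1 (complex_of_real (- l))"
    unfolding complex_eigenvalue_def
    by (rule exI[of _ eu], rule exI[of _ 0]) (simp add: A1_def eu_def prod_eq_iff algebra_simps)
  moreover have "complex_eigenvalue A1 (complex_of_real (- m))"
    unfolding complex_eigenvalue_def
    by (rule exI[of _ es], rule exI[of _ 0]) (simp add: A1_def es_def prod_eq_iff algebra_simps)
  moreover have "1 < cmod (complex_of_real (- l))" "cmod (complex_of_real (- m)) < 1"
    using l_gt m_pos m_less by (simp_all only: norm_of_real)
  moreover have "f (pt 0 0) = pt 0 0" using funpow_fixed_point[of 1] by simp
  ultimately show "saddle_fixed_point f (pt 0 0)" unfolding saddle_fixed_point_def using D by blast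
  show "snd (pt 0 0) < 0" using lm_pos c_pos by (simp add: pt_def)
qed

text \<open>A fixed point has y = - l m x, so y < 0 puts it into x > 0, where the affine branch has
  only one fixed point.\<close>

lemma fixed_point_below:
  assumes "f p = p" "snd p < 0"
  shows "p = pt 0 0"
proof -
  obtain x y where p: "p = (x, y)" by fastforce
  have "1 + y - (l + m) * \<bar>x\<bar> = x \<and> - (l * m) * x = y"
    using assms(1) unfolding p f_eq prod.inject .
  hence y: "y = - (l * m) * x" and x_eq: "1 + y - (l + m) * \<bar>x\<bar> = x" by auto
  have "0 < l * m * x" using assms(2) by (simp add: p y)
  hence "0 < x" using lm_pos by (rule zero_less_mult_pos)
  hence "x * ((1 + l) * (1 + m)) = 1" using x_eq unfolding y by (simp add: algebra_simps)
  moreover have "(1 + l) * (1 + m) \<noteq> 0" using l_pos m_pos by simp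
  ultimately have "x = c" unfolding c_def by (simp only: eq_divide_eq) simp
  thus ?thesis by (simp add: p pt_def y)
qed

end

text \<open>The numbers \<open>l\<close> and \<open>m\<close> are the roots of t^2 - a t - b, and
  \<open>r\<close> is the square root of its discriminant.\<close>

lemma U_minus_params:
  assumes "(a, b) \<in> U_minus"
  obtains l m where "lozi_saddle l m" "a = l + m" "b = - (l * m)"
proof -
  have a: "sqrt 2 < a" "a < 2" and b: "b < 0" "2 - sqrt 2 * a < b"
    and q: "16 / 9 \<le> a \<Longrightarrow> 1 / 8 * (3 * a^2 - 8 * a + sqrt (9 * a^4 - 16 * a^3)) < b"
    using assms by (auto simp: U_minus_def split: if_splits)
  have "1 < sqrt (2::real)" by simp
  hence pos: "0 < 2 * sqrt 2 - a" using a by linarith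
  define r where "r = sqrt (a\<^sup>2 + 4 * b)"
  \<comment> \<open>The bound 2 - sqrt 2 a < b amounts to r > 2 sqrt 2 - a, that is l > sqrt
    2.\<close>
  have "(2 * sqrt 2 - a)\<^sup>2 < a\<^sup>2 + 4 * b" using b(2) by (simp add: power2_diff power_mult_distrib)
  hence r_gt: "2 * sqrt 2 - a < r" unfolding r_def by (rule real_less_rsqrt)
  have "0 \<le> a\<^sup>2 + 4 * b" using \<open>(2 * sqrt 2 - a)\<^sup>2 < a\<^sup>2 + 4 * b\<close> zero_le_power2[of "2 * sqrt 2 - a"] by linarith
  hence r_sq: "r\<^sup>2 = a\<^sup>2 + 4 * b" by (simp add: r_def)
  have a0: "0 < a" using a(1) \<open>1 < sqrt 2\<close> by linarith
  have r_less: "r < a" unfolding r_def using a0 b by (intro real_less_lsqrt) auto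
  define l m where "l = (a + r) / 2" and "m = (a - r) / 2"
  have lm: "a = l + m" by (simp add: l_def m_def field_simps)
  have "l * m = (a\<^sup>2 - r\<^sup>2) / 4" by (simp add: l_def m_def power2_eq_square algebra_simps)
  hence b_eq: "b = - (l * m)" using r_sq by simp
  have l_gt: "sqrt 2 < l" using r_gt by (simp add: l_def)
  hence "(sqrt 2)\<^sup>2 < l\<^sup>2" by (intro power_strict_mono) auto
  hence "2 < l\<^sup>2" by simp
  moreover have "0 < l" using l_gt \<open>1 < sqrt 2\<close> by linarith
  moreover have "0 < m" using r_less by (simp add: m_def)
  moreover have "l + m < 2" using a(2) lm by simp
  moreover have "l\<^sup>2 + 3 * l * m < 2 * (l + m)"
  proof -
    \<comment> \<open>As a quadratic in \<open>r\<close> this has discriminant 9 a^2 - 16 a. For a <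
      16/9 it is positive throughout; otherwise it is positive beyond its larger root (a + w)/2, and
      the first entry of the maximum says that \<open>r\<close> lies there.\<close>
    have "0 < r\<^sup>2 - a * r + 2 * a * (2 - a)"
    proof (cases "16 / 9 \<le> a")
      case False
      have "r\<^sup>2 - a * r + 2 * a * (2 - a) = (r - a / 2)\<^sup>2 + a * (16 - 9 * a) / 4"
        by (simp add: power2_eq_square field_simps)
      moreover have "0 < a * (16 - 9 * a)" using False a0 by (intro mult_pos_pos) auto
      ultimately show ?thesis using zero_le_power2[of "r - a / 2"] by linarith
    next
      case True
      define w where "w = sqrt (9 * a\<^sup>2 - 16 * a)"
      have "0 \<le> a * (9 * a - 16)" using True a0 by (intro mult_nonneg_nonneg) auto
      hence nn: "0 \<le> 9 * a\<^sup>2 - 16 * a" by (simp add: power2_eq_square algebra_simps)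
      hence w: "0 \<le> w" "w\<^sup>2 = 9 * a\<^sup>2 - 16 * a" by (auto simp: w_def)
      have "9 * a^4 - 16 * a^3 = a\<^sup>2 * (9 * a\<^sup>2 - 16 * a)" by (simp add: eval_nat_numeral algebra_simps)
      hence "sqrt (9 * a^4 - 16 * a^3) = a * w" using a0 by (simp add: real_sqrt_mult w_def)
      hence "3 * a\<^sup>2 - 8 * a + a * w < 8 * b" using q[OF True] by simp
      hence "(a\<^sup>2 + 2 * (a * w) + w\<^sup>2) / 4 < r\<^sup>2" unfolding r_sq w(2) by (simp add: field_simps)
      moreover have "((a + w) / 2)\<^sup>2 = (a\<^sup>2 + 2 * (a * w) + w\<^sup>2) / 4" by (simp add: power2_eq_square algebra_simps)
      ultimately have "((a + w) / 2)\<^sup>2 < r\<^sup>2" by (simp only:)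
      hence "(a + w) / 2 < r" using r_gt pos by (intro power_less_imp_less_base[of _ 2 r]) auto
      hence "w < 2 * r - a" by simp
      hence "w\<^sup>2 < (2 * r - a)\<^sup>2" using w(1) by (intro power_strict_mono) auto
      thus ?thesis unfolding w(2) by (simp add: power2_eq_square algebra_simps)
    qed
    moreover have "2 * (l + m) - (l\<^sup>2 + 3 * l * m) = (r\<^sup>2 - a * r + 2 * a * (2 - a)) / 2"
      by (simp add: l_def m_def power2_eq_square field_simps)
    ultimately have "0 < 2 * (l + m) - (l\<^sup>2 + 3 * l * m)" by simp
    thus ?thesis by simp
  qed
  ultimately have "lozi_saddle l m"
    by unfold_locales
  thus ?thesis using that lm b_eq by blast
qed

theorem theorem1:
  fixes a b :: real
  assumes "(a, b) \<in> U_minus"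
  shows "(\<exists>!p. saddle_fixed_point (lozi a b) p \<and> snd p < 0) \<and>
    (\<forall>p. saddle_fixed_point (lozi a b) p \<and> snd p < 0 \<longrightarrow>
       (\<forall>\<epsilon>>0. chaotic_attractor (lozi a b) (closure (unstable_manifold (lozi a b) \<epsilon> p))))"
proof -
  obtain l m where lm: "lozi_saddle l m" "a = l + m" "b = - (l * m)" using U_minus_params[OF assms] .
  interpret lozi_saddle l m by (rule lm(1))
  have f: "lozi a b = f" by (simp add: f_def lm)
  have unique: "p = pt 0 0" if "saddle_fixed_point f p \<and> snd p < 0" for p
    using that fixed_point_below unfolding saddle_fixed_point_def by blast
  have "\<exists>!p. saddle_fixed_point f p \<and> snd p < 0"
    using saddle_fixed_point_pt unique by blast
  moreover have "chaotic_attractor f (closure (unstable_manifold f \<epsilon> p))"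
    if "saddle_fixed_point f p \<and> snd p < 0" "0 < \<epsilon>" for p \<epsilon>
    unfolding unique[OF that(1)] unstable_manifold_eq[OF that(2)] F_def[symmetric]
    by (rule chaotic_attractor_F)
  ultimately show ?thesis unfolding f by blast
qed

end
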